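(* Let $\mathcal{B}\subset \mathrm{Gr}_{m,n}$ be a geodesically convex open ball containing points $Q_1,\dots,Q_N$ ($N\ge 1$). For $P\in\mathcal{B}$ and each $i=1,\dots,N$, let $\xi_i=\xi_i(P)\in T_{Q_i}\mathrm{Gr}_{m,n}$ be the unique tangent vector that is the initial velocity of the unique shortest geodesic $[0,1]\to\mathcal{B}$ from $Q_i$ to $P$, so that $$P=\exp_{Q_i}(\xi_i)=e^{[\xi_i,Q_i]}\,Q_i\,e^{-[\xi_i,Q_i]}\quad\text{and}\quad \operatorname{tr}(\xi_i^2)=\operatorname{dist}^2(P,Q_i).$$ Define the Karcher mean function $$F\colon\mathcal{B}\to\mathbb{R},\qquad F(P)=\frac1N\sum_{i=1}^N\operatorname{dist}^2(P,Q_i).$$ Then for every $P\in\mathcal{B}$ the Riemannian gradient of $F$ at $P$ is $$\operatorname{grad}F(P)=\frac{2}{N}\sum_{i=1}^N\big[[\xi_i,Q_i],P\big].$$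
   Context: For integers $0<m<n$, the complex Grassmannian is identified with the set of rank-$m$ Hermitian projectors $$\mathrm{Gr}_{m,n}=\{P\in\mathbb{C}^{n\times n}\mid P^{\mathsf H}=P,\ P^2=P,\ \operatorname{tr}P=m\},$$ where $(\cdot)^{\mathsf H}$ is the conjugate transpose. It is a smooth compact submanifold of the real vector space $\mathrm{Herm}_n$ of Hermitian $n\times n$ matrices, with tangent space $T_P\mathrm{Gr}_{m,n}=\{P\Omega-\Omega P\mid \Omega\in\mathbb{C}^{n\times n},\ \Omega^{\mathsf H}=-\Omega\}$. The matrix commutator is $[X,Y]=XY-YX$. The Riemannian metric is the one induced by the Frobenius inner product on $\mathrm{Herm}_n$: $g_P(H_1,H_2)=\operatorname{tr}(H_1H_2)$ for $H_1,H_2\in T_P\mathrm{Gr}_{m,n}$. The geodesic with initial point $P_0$ and initial velocity $H\in T_{P_0}\mathrm{Gr}_{m,n}$ is $P_H(t)=e^{t[H,P_0]}P_0e^{-t[H,P_0]}$, and the Riemannian exponential map is $\exp_{P_0}(H)=P_H(1)$. $\operatorname{dist}$ is the Riemannian distance for this metric. A geodesically convex open ball $\mathcal{B}$ is an open ball such that any two points of $\mathcal{B}$ can be connected by a unique shortest geodesic, which is contained completely in $\mathcal{B}$; accordingly the Riemannian exponential maps are bijective onto $\mathcal{B}$ when restricted to the initial velocities of these shortest geodesics. The Riemannian gradient $\operatorname{grad}F(P)$ is the unique element of $T_P\mathrm{Gr}_{m,n}$ with $\mathrm{D}F(P)H=g_P(\operatorname{grad}F(P),H)$ for all $H\in T_P\mathrm{Gr}_{m,n}$,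 where $\mathrm{D}F(P)H$ is the directional derivative. *)

theory Defs
  imports "HOL-Analysis.Analysis"
begin

definition hconj :: "complex^'n^'n \<Rightarrow> complex^'n^'n" where
  "hconj A = (\<chi> i j. cnj (A $ j $ i))"

definition comm :: "complex^'n^'n \<Rightarrow> complex^'n^'n \<Rightarrow> complex^'n^'n" where
  "comm X Y = X ** Y - Y ** X"

(* The power operation of the type class on vec is componentwise, so the matrix power
   is written as an iterated matrix product. *)
definition mexp :: "complex^'n^'n \<Rightarrow> complex^'n^'n" where
  "mexp A = (\<Sum>k. (1 / fact k) *\<^sub>R (((**) A ^^ k) (mat 1)))"

definition Grass :: "nat \<Rightarrow> (complex^'n^'n) set" where
  "Grass m = {P. hconj P = P \<and> P ** P = P \<and> trace P = of_nat m}"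

definition tangent :: "complex^'n^'n \<Rightarrow> (complex^'n^'n) set" where
  "tangent P = {P ** \<Omega> - \<Omega> ** P | \<Omega>. hconj \<Omega> = - \<Omega>}"

(* The trace of a product of two Hermitian matrices is real; Re only adjusts the type. *)
definition grass_metric :: "complex^'n^'n \<Rightarrow> complex^'n^'n \<Rightarrow> real" where
  "grass_metric H1 H2 = Re (trace (H1 ** H2))"

definition speed :: "(real \<Rightarrow> complex^'n^'n) \<Rightarrow> real \<Rightarrow> real" where
  "speed \<gamma> t = sqrt (grass_metric (vector_derivative \<gamma> (at t)) (vector_derivative \<gamma> (at t)))"

definition curve_length :: "(real \<Rightarrow> complex^'n^'n) \<Rightarrow> real" where
  "curve_length \<gamma> = integral {0..1} (speed \<gamma>)"

(* valid_path does not bound the derivative near the finitely many exceptional points.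
   Without the integrability condition a curve of infinite length would be assigned
   the value 0 by curve_length. *)
definition connecting_curve ::
    "nat \<Rightarrow> complex^'n^'n \<Rightarrow> complex^'n^'n \<Rightarrow> (real \<Rightarrow> complex^'n^'n) \<Rightarrow> bool" where
  "connecting_curve m P Q \<gamma> \<longleftrightarrow>
     valid_path \<gamma> \<and> path_image \<gamma> \<subseteq> Grass m \<and> pathstart \<gamma> = P \<and> pathfinish \<gamma> = Q \<and>
     speed \<gamma> integrable_on {0..1}"

definition grass_dist :: "nat \<Rightarrow> complex^'n^'n \<Rightarrow> complex^'n^'n \<Rightarrow> real" where
  "grass_dist m P Q = Inf {curve_length \<gamma> | \<gamma>. connecting_curve m P Q \<gamma>}"

definition geodesic :: "complex^'n^'n \<Rightarrow> complex^'n^'n \<Rightarrow> real \<Rightarrow> complex^'n^'n" where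
  "geodesic P H t = mexp (t *\<^sub>R comm H P) ** P ** mexp (- (t *\<^sub>R comm H P))"

definition riem_exp :: "complex^'n^'n \<Rightarrow> complex^'n^'n \<Rightarrow> complex^'n^'n" where
  "riem_exp P H = geodesic P H 1"

(* Only the values of \<gamma> on [0,1] matter. *)
definition shortest_geodesic ::
    "nat \<Rightarrow> complex^'n^'n \<Rightarrow> complex^'n^'n \<Rightarrow> (real \<Rightarrow> complex^'n^'n) \<Rightarrow> bool" where
  "shortest_geodesic m P Q \<gamma> \<longleftrightarrow>
     (\<exists>H\<in>tangent P. \<forall>t\<in>{0..1}. \<gamma> t = geodesic P H t) \<and> \<gamma> 1 = Q \<and>
     curve_length \<gamma> = grass_dist m P Q"

definition open_ball :: "nat \<Rightarrow> complex^'n^'n \<Rightarrow> real \<Rightarrow> (complex^'n^'n) set" where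
  "open_ball m C r = {P \<in> Grass m. grass_dist m C P < r}"

(* Uniqueness is among all shortest geodesics of the Grassmannian, not only those in B. *)
definition geodesically_convex_open_ball :: "nat \<Rightarrow> (complex^'n^'n) set \<Rightarrow> bool" where
  "geodesically_convex_open_ball m B \<longleftrightarrow>
     (\<exists>C\<in>Grass m. \<exists>r>0. B = open_ball m C r) \<and>
     (\<forall>P\<in>B. \<forall>Q\<in>B. \<exists>\<gamma>. shortest_geodesic m P Q \<gamma> \<and> \<gamma> ` {0..1} \<subseteq> B \<and>
        (\<forall>\<gamma>'. shortest_geodesic m P Q \<gamma>' \<longrightarrow> (\<forall>t\<in>{0..1}. \<gamma>' t = \<gamma> t)))"

definition is_initial_velocity ::
    "nat \<Rightarrow> (complex^'n^'n) set \<Rightarrow> complex^'n^'n \<Rightarrow> complex^'n^'n \<Rightarrow> complex^'n^'n \<Rightarrow> bool" where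
  "is_initial_velocity m B Q P \<xi> \<longleftrightarrow> \<xi> \<in> tangent Q \<and>
     (\<exists>\<gamma>. shortest_geodesic m Q P \<gamma> \<and> \<gamma> ` {0..1} \<subseteq> B \<and>
        (\<gamma> has_vector_derivative \<xi>) (at 0 within {0..1}))"

definition initial_velocity ::
    "nat \<Rightarrow> (complex^'n^'n) set \<Rightarrow> complex^'n^'n \<Rightarrow> complex^'n^'n \<Rightarrow> complex^'n^'n" where
  "initial_velocity m B Q P = (THE \<xi>. is_initial_velocity m B Q P \<xi>)"

definition karcher_mean_fun ::
    "nat \<Rightarrow> nat \<Rightarrow> (nat \<Rightarrow> complex^'n^'n) \<Rightarrow> complex^'n^'n \<Rightarrow> real" where
  "karcher_mean_fun m N Q P = (1 / real N) * (\<Sum>i=1..N. (grass_dist m P (Q i))\<^sup>2)"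

(* DF(P)H = d: along every curve in the Grassmannian through P with velocity H at time 0,
   the derivative of F at time 0 exists and equals d. *)
definition has_directional_derivative ::
    "nat \<Rightarrow> (complex^'n^'n \<Rightarrow> real) \<Rightarrow> complex^'n^'n \<Rightarrow> complex^'n^'n \<Rightarrow> real \<Rightarrow> bool" where
  "has_directional_derivative m F P H d \<longleftrightarrow>
     (\<forall>\<gamma>. \<gamma> 0 = P \<and> (\<forall>\<^sub>F t in nhds 0. \<gamma> t \<in> Grass m) \<and> (\<gamma> has_vector_derivative H) (at 0) \<longrightarrow>
        ((\<lambda>t. F (\<gamma> t)) has_real_derivative d) (at 0))"

definition has_riem_gradient ::
    "nat \<Rightarrow> (complex^'n^'n \<Rightarrow> real) \<Rightarrow> complex^'n^'n \<Rightarrow> complex^'n^'n \<Rightarrow> bool" where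
  "has_riem_gradient m F P G \<longleftrightarrow> G \<in> tangent P \<and>
     (\<forall>H\<in>tangent P. has_directional_derivative m F P H (grass_metric G H))"

definition riem_gradient ::
    "nat \<Rightarrow> (complex^'n^'n \<Rightarrow> real) \<Rightarrow> complex^'n^'n \<Rightarrow> complex^'n^'n" where
  "riem_gradient m F P = (THE G. has_riem_gradient m F P G)"

end

theory Submission
  imports Defs
begin

text \<open>
  Let \<open>P = exp\<^sub>Q \<xi>\<close> and \<open>A = [\<xi>, Q]\<close>. For skew-Hermitian \<open>\<Omega>\<close> the curve
  \<open>e\<^bsup>t\<Omega>\<^esup> e\<^bsup>tA\<^esup> Q e\<^bsup>-tA\<^esup> e\<^bsup>-t\<Omega>\<^esup>\<close> joins \<open>Q\<close> to \<open>P' = e\<^bsup>\<Omega>\<^esup> P e\<^bsup>-\<Omega>\<^esup>\<close>, and comparing its length with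
  the distance gives \<open>dist\<^sup>2(Q, P') \<le> |\<xi>|\<^sup>2 - 2 Re tr(A\<Omega>) + 4m|\<Omega>|\<^sup>2\<close>. Every projector \<open>P'\<close> near \<open>P\<close>
  is of this form with \<open>\<Omega> = [P' - P, P] + O(|P' - P|\<^sup>2)\<close>. The reverse inequality is the same one
  with the roles of \<open>P\<close> and \<open>P'\<close> exchanged: the minimizing velocity towards \<open>P'\<close> converges to \<open>\<xi>\<close>,
  by compactness and the uniqueness of shortest geodesics. Hence the squared distance is
  differentiable at \<open>P\<close> without any discussion of conjugate points.
\<close>

text \<open>The linear term is explicit because A stays off-diagonal for every projector q on the
  geodesic from Q: Aq + qA = A. This gives tr([A,q][\<Omega>,q]) = -tr(A\<Omega>) for arbitrary
  \<Omega>, so the first-order change of the squared speed depends on A and \<Omega> alone and not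
  on the position along the curve. With D = P' - P, \<Omega> may be replaced by [D,P] up to
  O(|D|^2), and -2 tr(A[D,P]) = 2 tr([A,P]D) is the origin of the double commutator and of the
  factor 2 in the gradient.

  The distance is an infimum, so an explicit curve bounds it from above only. In the exchanged
  inequality the velocity towards P' stands in place of \<xi>; the two linear terms agree up to
  o(|D|) as soon as that velocity converges, at whatever rate.

  The gradient is tested along all curves of projectors that are differentiable at a single instant.
  This asks for a Frechet derivative within the set of projectors, in the ambient Frobenius norm,
  and so the intrinsically defined ball has to be shown to contain all projectors that are close to
  P in that norm.\<close>

section \<open>Conjugate transpose, trace form and Frobenius norm\<close>

lemma hconj_nth: "hconj A $ i $ j = cnj (A $ j $ i)"
  by (simp add: hconj_def)

lemma hconj_hconj [simp]: "hconj (hconj A) = A"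
  and hconj_add [simp]: "hconj (A + B) = hconj A + hconj B"
  and hconj_diff [simp]: "hconj (A - B) = hconj A - hconj B"
  and hconj_minus [simp]: "hconj (- A) = - hconj A"
  and hconj_scaleR [simp]: "hconj (r *\<^sub>R A) = r *\<^sub>R hconj A"
  and hconj_0 [simp]: "hconj 0 = 0"
  and hconj_mat_1 [simp]: "hconj (mat 1) = mat 1"
  by (auto simp: vec_eq_iff hconj_nth mat_def)

lemma hconj_mult: "hconj (A ** B) = hconj B ** hconj A"
  by (simp add: vec_eq_iff hconj_nth matrix_matrix_mult_def mult.commute)

lemma trace_hconj: "trace (hconj A) = cnj (trace A)"
  by (simp add: trace_def hconj_nth)

lemma norm_hconj [simp]: "norm (hconj A) = norm A"
proof -
  have sq: "(norm B)\<^sup>2 = (\<Sum>i\<in>UNIV. \<Sum>j\<in>UNIV. (norm (B $ i $ j))\<^sup>2)" for B :: "complex^'n^'n"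
    by (simp add: norm_vec_def L2_set_def sum_nonneg)
  have "(norm (hconj A))\<^sup>2 = (norm A)\<^sup>2"
    unfolding sq hconj_nth complex_mod_cnj by (rule sum.swap)
  then show ?thesis
    by simp
qed

lemma bounded_linear_hconj: "bounded_linear hconj"
  by (rule bounded_linear_intro[of _ 1]) auto

text \<open>One conjugate transpose turns the trace form into the Euclidean inner product of the
  vector type. Bilinearity and Cauchy-Schwarz follow; the form is the squared norm on Hermitian
  matrices and its negative on skew-Hermitian ones.\<close>

lemma grass_metric_inner: "grass_metric A B = A \<bullet> hconj B"
  by (simp add: grass_metric_def trace_def matrix_matrix_mult_def inner_vec_def hconj_nth
      inner_complex_def)

lemma grass_metric_add: "grass_metric (A + A') B = grass_metric A B + grass_metric A' B"
  and grass_metric_diff: "grass_metric (A - A') B = grass_metric A B - grass_metric A' B"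
  and grass_metric_scaleR: "grass_metric (r *\<^sub>R A) B = r * grass_metric A B"
  by (simp_all add: grass_metric_inner inner_left_distrib inner_diff_left)

lemma grass_metric_sum: "grass_metric (\<Sum>i\<in>I. f i) B = (\<Sum>i\<in>I. grass_metric (f i) B)"
  by (simp add: grass_metric_inner inner_sum_left)

lemma grass_metric_le: "\<bar>grass_metric A B\<bar> \<le> norm A * norm B"
  using Cauchy_Schwarz_ineq2[of A "hconj B"] by (simp add: grass_metric_inner)

lemma grass_metric_hermitian: "hconj A = A \<Longrightarrow> grass_metric A A = (norm A)\<^sup>2"
  by (simp add: grass_metric_inner power2_norm_eq_inner)

lemma bounded_linear_grass_metric: "bounded_linear (grass_metric A)"
  unfolding grass_metric_inner
  by (intro bounded_linear_compose[OF bounded_linear_inner_right bounded_linear_hconj])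

text \<open>Cauchy-Schwarz in every entry. The norm of the nested vector type is the Frobenius norm,
  so the estimates for the metric and those for power series share one norm.\<close>

lemma norm_matrix_mult:
  fixes A B :: "complex^'n^'n"
  shows "norm (A ** B) \<le> norm A * norm B"
proof -
  have sq: "(norm C)\<^sup>2 = (\<Sum>i\<in>UNIV. \<Sum>j\<in>UNIV. (norm (C $ i $ j))\<^sup>2)" for C :: "complex^'n^'n"
    by (simp add: norm_vec_def L2_set_def sum_nonneg)
  have entry: "(norm ((A ** B) $ i $ j))\<^sup>2
      \<le> (\<Sum>k\<in>UNIV. (norm (A $ i $ k))\<^sup>2) * (\<Sum>k\<in>UNIV. (norm (B $ k $ j))\<^sup>2)" for i j
  proof -
    have "norm ((A ** B) $ i $ j) \<le> (\<Sum>k\<in>UNIV. \<bar>norm (A $ i $ k)\<bar> * \<bar>norm (B $ k $ j)\<bar>)"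
      by (simp add: matrix_matrix_mult_def norm_mult[symmetric] sum_norm_le)
    also have "\<dots> \<le> L2_set (\<lambda>k. norm (A $ i $ k)) UNIV * L2_set (\<lambda>k. norm (B $ k $ j)) UNIV"
      by (rule L2_set_mult_ineq)
    finally have "(norm ((A ** B) $ i $ j))\<^sup>2
        \<le> (L2_set (\<lambda>k. norm (A $ i $ k)) UNIV * L2_set (\<lambda>k. norm (B $ k $ j)) UNIV)\<^sup>2"
      by (rule power_mono) simp
    then show ?thesis
      by (simp add: L2_set_def power_mult_distrib sum_nonneg)
  qed
  have "(norm (A ** B))\<^sup>2
      \<le> (\<Sum>i\<in>UNIV. \<Sum>j\<in>UNIV. (\<Sum>k\<in>UNIV. (norm (A $ i $ k))\<^sup>2) * (\<Sum>k\<in>UNIV. (norm (B $ k $ j))\<^sup>2))"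
    unfolding sq[of "A ** B"] by (intro sum_mono entry)
  also have "\<dots> = (norm A)\<^sup>2 * (\<Sum>j\<in>UNIV. \<Sum>k\<in>UNIV. (norm (B $ k $ j))\<^sup>2)"
    by (simp add: sq sum_product)
  also have "\<dots> = (norm A * norm B)\<^sup>2"
    unfolding sq[of B] power_mult_distrib
    by (rule arg_cong[where f = "(*) _"], rule sum.swap)
  finally show ?thesis
    by (rule power2_le_imp_le) simp
qed

lemma matrix_scaleR_left: "(r *\<^sub>R A) ** B = r *\<^sub>R (A ** B)"
  and matrix_scaleR_right: "A ** (r *\<^sub>R B) = r *\<^sub>R (A ** B)"
  for A B :: "complex^'n^'n"
  by (simp_all add: vec_eq_iff matrix_matrix_mult_def scaleR_sum_right)

lemma matrix_minus_left: "(- A) ** B = - (A ** B)"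
  and matrix_minus_right: "A ** (- B) = - (A ** B)"
  and matrix_zero_left: "0 ** B = 0"
  and matrix_zero_right: "A ** 0 = 0"
  and matrix_diff_ldistrib: "A ** (B - C) = A ** B - A ** C"
  and matrix_diff_rdistrib: "(A - C) ** B = A ** B - C ** B"
  for A B C :: "complex^'n^'n"
  by (simp_all add: vec_eq_iff matrix_matrix_mult_def sum_negf algebra_simps sum_subtractf)

lemma matrix_add_rdistrib: "(A + C) ** B = A ** B + C ** B"
  for A B C :: "complex^'n^'n"
  by (simp add: vec_eq_iff matrix_matrix_mult_def algebra_simps sum.distrib)

lemmas matrix_simps = matrix_scaleR_left matrix_scaleR_right matrix_minus_left matrix_minus_right
  matrix_zero_left matrix_zero_right matrix_diff_ldistrib matrix_diff_rdistrib
  matrix_add_ldistrib matrix_add_rdistrib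

lemma bounded_bilinear_matrix_mult:
  "bounded_bilinear ((**) :: complex^'n^'n \<Rightarrow> complex^'n^'n \<Rightarrow> complex^'n^'n)"
proof
  show "\<exists>K. \<forall>(a :: complex^'n^'n) (b :: complex^'n^'n). norm (a ** b) \<le> norm a * norm b * K"
    by (intro exI[of _ 1]) (simp add: norm_matrix_mult)
qed (simp_all add: matrix_simps)

lemmas bounded_linear_matrix_mult_left =
  bounded_bilinear.bounded_linear_left[OF bounded_bilinear_matrix_mult]
lemmas bounded_linear_matrix_mult_right =
  bounded_bilinear.bounded_linear_right[OF bounded_bilinear_matrix_mult]
lemmas continuous_on_matrix_mult [continuous_intros] =
  bounded_bilinear.continuous_on[OF bounded_bilinear_matrix_mult]
lemmas has_vector_derivative_matrix_mult =
  bounded_bilinear.has_vector_derivative[OF bounded_bilinear_matrix_mult]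

lemma comm_diff_left: "comm (A - B) C = comm A C - comm B C"
  and comm_add_left: "comm (A + B) C = comm A C + comm B C"
  and comm_0_left: "comm 0 C = 0"
  by (simp_all add: comm_def matrix_simps algebra_simps)

lemma norm_comm_le: "norm (comm A B) \<le> 2 * norm A * norm B"
  using norm_triangle_ineq4[of "A ** B" "B ** A"] norm_matrix_mult[of A B] norm_matrix_mult[of B A]
  by (simp add: comm_def mult.commute mult.left_commute)

section \<open>The matrix exponential\<close>

abbreviation mpow :: "complex^'n^'n \<Rightarrow> nat \<Rightarrow> complex^'n^'n" where
  "mpow A k \<equiv> (((**) A ^^ k) (mat 1))"

text \<open>The factor \<open>norm (mat 1)\<close> is attained at k = 0: the Frobenius norm of the
  identity is the square root of the dimension, not 1.\<close>

lemma norm_mpow_le: "norm (mpow A k) \<le> norm (mat 1 :: complex^'n^'n) * norm A ^ k"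
  for A :: "complex^'n^'n"
proof (induction k)
  case (Suc k)
  have "norm (mpow A (Suc k)) \<le> norm A * norm (mpow A k)"
    by (simp add: norm_matrix_mult)
  also have "\<dots> \<le> norm A * (norm (mat 1 :: complex^'n^'n) * norm A ^ k)"
    by (intro mult_left_mono Suc) simp
  finally show ?case
    by (simp add: mult_ac)
qed simp

lemma mpow_scaleR: "mpow (t *\<^sub>R A) k = t ^ k *\<^sub>R mpow A k"
  by (induction k) (simp_all add: matrix_simps)

lemma summable_mexp: "summable (\<lambda>k. (1 / fact k) *\<^sub>R mpow A k)"
  for A :: "complex^'n^'n"
proof (rule summable_comparison_test')
  show "summable (\<lambda>k. norm (mat 1 :: complex^'n^'n) * (inverse (fact k) * norm A ^ k))"
    by (intro summable_mult summable_exp)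
  show "norm ((1 / fact k) *\<^sub>R mpow A k) \<le> norm (mat 1 :: complex^'n^'n) * (inverse (fact k) * norm A ^ k)"
    if "k \<ge> 0" for k
    using norm_mpow_le[of k A] by (simp add: divide_simps mult.commute)
qed

lemma mexp_sums: "(\<lambda>k. (1 / fact k) *\<^sub>R mpow A k) sums mexp A"
  unfolding mexp_def by (rule summable_sums[OF summable_mexp])

lemma mexp_0 [simp]: "mexp (0 :: complex^'n^'n) = mat 1"
proof -
  have "(\<lambda>k. (1 / fact k) *\<^sub>R mpow (0 :: complex^'n^'n) k) = (\<lambda>k. if k = 0 then mat 1 else 0)"
  proof
    show "(1 / fact k) *\<^sub>R mpow (0 :: complex^'n^'n) k = (if k = 0 then mat 1 else 0)" for k
      by (cases k) (simp_all add: matrix_simps)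
  qed
  moreover have "(\<lambda>k. if k = 0 then mat 1 else 0 :: complex^'n^'n) sums mat 1"
    by (rule sums_single)
  ultimately show ?thesis
    using sums_unique2[OF mexp_sums[of "0 :: complex^'n^'n"]] by simp
qed

text \<open>Telescoping. Exponents start at 1 so that the norm of the identity does not enter the
  bound.\<close>

lemma norm_mpow_diff_le:
  fixes r :: real
  assumes "norm A \<le> r" "norm B \<le> r"
  shows "norm (mpow A (Suc k) - mpow B (Suc k)) \<le> Suc k * r ^ k * norm (A - B)"
proof (induction k)
  case (Suc k)
  have r: "r \<ge> 0"
    using assms(1) norm_ge_zero order_trans by blast
  have pow: "norm (mpow B (Suc k)) \<le> r ^ Suc k" for k
  proof (induction k)
    case (Suc k)
    have "norm (mpow B (Suc (Suc k))) \<le> norm B * norm (mpow B (Suc k))"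
      using norm_matrix_mult by simp
    also have "\<dots> \<le> r * r ^ Suc k"
      by (intro mult_mono assms Suc r) simp
    finally show ?case
      by simp
  qed (use assms in simp)
  have "mpow A (Suc (Suc k)) - mpow B (Suc (Suc k))
      = A ** (mpow A (Suc k) - mpow B (Suc k)) + (A - B) ** mpow B (Suc k)"
    by (simp add: matrix_simps)
  then have "norm (mpow A (Suc (Suc k)) - mpow B (Suc (Suc k)))
      \<le> norm A * norm (mpow A (Suc k) - mpow B (Suc k)) + norm (A - B) * norm (mpow B (Suc k))"
    by (simp only:) (intro norm_triangle_mono norm_matrix_mult)
  also have "\<dots> \<le> r * (Suc k * r ^ k * norm (A - B)) + norm (A - B) * r ^ Suc k"
    by (intro add_mono mult_mono Suc assms pow) (use r in auto)
  finally show ?case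
    by (simp add: algebra_simps)
qed simp

text \<open>The term of index k + 1 is at most r^k/k! times the norm of A - B. Removing the linear
  term replaces \<open>exp r\<close> by \<open>exp r - 1\<close>, which is small for small r and
  yields the contraction behind the local logarithm.\<close>

lemma mexp_lipschitz:
  assumes "norm A \<le> r" "norm B \<le> r"
  shows "norm (mexp A - mexp B) \<le> exp r * norm (A - B)"
    and "norm (mexp A - mexp B - (A - B)) \<le> (exp r - 1) * norm (A - B)"
proof -
  define f where "f k = (1 / fact k) *\<^sub>R (mpow A k - mpow B k)" for k
  have f: "f sums (mexp A - mexp B)"
    using sums_diff[OF mexp_sums[of A] mexp_sums[of B]] by (simp add: f_def[abs_def] scaleR_diff_right)
  have bound: "norm (f (Suc k)) \<le> inverse (fact k) * r ^ k * norm (A - B)" for k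
  proof -
    have "norm (f (Suc k)) = (1 / fact (Suc k)) * norm (mpow A (Suc k) - mpow B (Suc k))"
      by (simp add: f_def del: fact_Suc)
    also have "\<dots> \<le> (1 / fact (Suc k)) * (Suc k * r ^ k * norm (A - B))"
      by (intro mult_left_mono norm_mpow_diff_le assms) simp
    also have "\<dots> = inverse (fact k) * r ^ k * norm (A - B)"
      by (simp add: divide_simps) (simp add: algebra_simps)?
    finally show ?thesis .
  qed
  have exp: "(\<lambda>k. inverse (fact k) * r ^ k) sums exp r"
    using exp_converges[of r] by simp
  \<comment> \<open>The term \<open>f 0\<close> vanishes, both powers being the identity, and
    \<open>f 1\<close> is A - B; shifting the index once or twice gives the two series.\<close>
  have f1: "(\<lambda>k. f (Suc k)) sums (mexp A - mexp B)"
    using f by (subst sums_Suc_iff) (simp add: f_def)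
  have f2: "(\<lambda>k. f (Suc (Suc k))) sums (mexp A - mexp B - (A - B))"
    using f1 by (subst sums_Suc_iff) (simp add: f_def)
  have exp1: "(\<lambda>k. inverse (fact (Suc k)) * r ^ Suc k) sums (exp r - 1)"
    using exp by (subst sums_Suc_iff) simp
  show "norm (mexp A - mexp B) \<le> exp r * norm (A - B)"
    using norm_suminf_le[of "\<lambda>k. f (Suc k)", OF bound] sums_mult2[OF exp, of "norm (A - B)"] f1
    by (simp add: sums_iff)
  show "norm (mexp A - mexp B - (A - B)) \<le> (exp r - 1) * norm (A - B)"
    using norm_suminf_le[of "\<lambda>k. f (Suc (Suc k))", OF bound] sums_mult2[OF exp1, of "norm (A - B)"] f2
    by (simp add: sums_iff del: fact_Suc power_Suc)
qed

lemma continuous_on_mexp: "continuous_on S mexp"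
proof (rule continuous_at_imp_continuous_on, rule ballI)
  fix A :: "complex^'n^'n"
  define L where "L = exp (norm A + 1)"
  have "((\<lambda>B. mexp B - mexp A) \<longlongrightarrow> 0) (at A)"
  proof (rule Lim_null_comparison)
    show "\<forall>\<^sub>F B in at A. norm (mexp B - mexp A) \<le> L * norm (B - A)"
      unfolding eventually_at
    proof (intro exI[of _ 1] conjI ballI impI)
      fix B
      assume "B \<noteq> A \<and> dist B A < 1"
      then have "norm B \<le> norm A + 1"
        using norm_triangle_ineq2[of B A] by (simp add: dist_norm)
      then show "norm (mexp B - mexp A) \<le> L * norm (B - A)"
        unfolding L_def by (intro mexp_lipschitz) auto
    qed simp
    show "((\<lambda>B. L * norm (B - A)) \<longlongrightarrow> 0) (at A)"
      by (auto intro!: tendsto_eq_intros)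
  qed
  then show "isCont mexp A"
    by (simp add: isCont_def LIM_zero_iff)
qed

text \<open>The relation passes to powers and then to the series. With X = A = B it says that a
  matrix commutes with its exponential; with a reflection for X it conjugates or inverts
  exponentials.\<close>

lemma mexp_intertwine:
  fixes A B X :: "complex^'n^'n"
  assumes "X ** A = B ** X"
  shows "X ** mexp A = mexp B ** X"
proof -
  have *: "X ** mpow A k = mpow B k ** X" for k
  proof (induction k)
    case (Suc k)
    have "X ** mpow A (Suc k) = B ** (X ** mpow A k)"
      by (simp add: matrix_mul_assoc assms)
    then show ?case
      by (simp add: Suc matrix_mul_assoc)
  qed simp
  have "(\<lambda>k. X ** ((1 / fact k) *\<^sub>R mpow A k)) sums (X ** mexp A)"
    using bounded_linear.sums[OF bounded_linear_matrix_mult_right mexp_sums] .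
  moreover have "(\<lambda>k. ((1 / fact k) *\<^sub>R mpow B k) ** X) sums (mexp B ** X)"
    using bounded_linear.sums[OF bounded_linear_matrix_mult_left mexp_sums] .
  ultimately show ?thesis
    by (simp add: matrix_simps * sums_unique2)
qed

lemma hconj_mexp: "hconj (mexp A) = mexp (hconj A)"
proof -
  have *: "hconj (mpow A k) = mpow (hconj A) k" for k
  proof (induction k)
    case (Suc k)
    have "mpow (hconj A) j ** hconj A = hconj A ** mpow (hconj A) j" for j
      by (induction j) (simp_all add: matrix_mul_assoc[symmetric])
    then show ?case
      by (simp add: hconj_mult Suc)
  qed simp
  have "(\<lambda>k. hconj ((1 / fact k) *\<^sub>R mpow A k)) sums hconj (mexp A)"
    by (rule bounded_linear.sums[OF bounded_linear_hconj mexp_sums])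
  then show ?thesis
    using mexp_sums[of "hconj A"] by (simp add: * sums_unique2)
qed

text \<open>Reduces matrix-valued curves to their entries, where termwise differentiation of complex
  power series is available.\<close>

lemma has_vector_derivative_vec:
  fixes f :: "real \<Rightarrow> 'a::real_normed_vector^'n"
  assumes "\<And>i. ((\<lambda>t. f t $ i) has_vector_derivative f' $ i) (at t)"
  shows "(f has_vector_derivative f') (at t)"
proof -
  have "((\<lambda>y. ((f y - f t) - (y - t) *\<^sub>R f') /\<^sub>R norm (y - t)) \<longlongrightarrow> 0) (at t)"
  proof (rule vec_tendstoI)
    fix i
    show "((\<lambda>y. (((f y - f t) - (y - t) *\<^sub>R f') /\<^sub>R norm (y - t)) $ i) \<longlongrightarrow> 0 $ i) (at t)"
      using assms[of i] unfolding has_vector_derivative_def has_derivative_at_within by simp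
  qed
  then show ?thesis
    unfolding has_vector_derivative_def has_derivative_at_within
    by (simp add: bounded_linear_scaleR_left)
qed

lemma mexp_has_vector_derivative:
  "((\<lambda>t. mexp (t *\<^sub>R A)) has_vector_derivative A ** mexp (t *\<^sub>R A)) (at t)"
proof (intro has_vector_derivative_vec)
  fix i j
  define c where "c k = of_real (1 / fact k) * mpow A k $ i $ j" for k
  have comp: "bounded_linear (\<lambda>X :: complex^'a^'a. X $ i $ j)"
    by (intro bounded_linear_compose[OF bounded_linear_vec_nth bounded_linear_vec_nth])
  have sums: "(\<lambda>k. c k * of_real s ^ k) sums (mexp (s *\<^sub>R A) $ i $ j)" for s :: real
    using bounded_linear.sums[OF comp mexp_sums[of "s *\<^sub>R A"]]
    by (simp add: c_def mpow_scaleR scaleR_conv_of_real[where 'a = complex] mult_ac)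
  have "(\<lambda>k. (A ** ((1 / fact k) *\<^sub>R mpow (t *\<^sub>R A) k)) $ i $ j) sums ((A ** mexp (t *\<^sub>R A)) $ i $ j)"
    by (intro bounded_linear.sums[OF comp] bounded_linear.sums[OF bounded_linear_matrix_mult_right]
        mexp_sums)
  moreover have "(A ** ((1 / fact k) *\<^sub>R mpow (t *\<^sub>R A) k)) $ i $ j = diffs c k * of_real t ^ k" for k
    by (simp add: diffs_def c_def mpow_scaleR matrix_simps scaleR_conv_of_real[where 'a = complex] field_simps
        del: of_nat_Suc)
  ultimately have deriv: "(\<lambda>k. diffs c k * of_real t ^ k) sums ((A ** mexp (t *\<^sub>R A)) $ i $ j)"
    by simp
  \<comment> \<open>Convergence is known at real arguments only; the real point
    \<open>norm z + 1\<close> lies farther out than z, so the series converges at every complex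
    z.\<close>
  have "summable (\<lambda>k. c k * z ^ k)" for z
  proof (rule powser_inside)
    show "summable (\<lambda>k. c k * of_real (norm z + 1) ^ k)"
      using sums by (rule sums_summable)
  qed (simp del: of_real_add)
  from termdiffs_strong_converges_everywhere[OF this, of "of_real t"]
  have "((\<lambda>x. \<Sum>k. c k * x ^ k) has_field_derivative (A ** mexp (t *\<^sub>R A)) $ i $ j) (at (of_real t))"
    using deriv by (simp add: sums_iff)
  then have "((\<lambda>s. \<Sum>k. c k * of_real s ^ k) has_vector_derivative (A ** mexp (t *\<^sub>R A)) $ i $ j) (at t)"
    by (rule has_vector_derivative_real_field)
  moreover have "(\<lambda>s. \<Sum>k. c k * of_real s ^ k) = (\<lambda>s. mexp (s *\<^sub>R A) $ i $ j)"
    using sums by (auto simp: sums_iff)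
  ultimately show "((\<lambda>s. mexp (s *\<^sub>R A) $ i $ j) has_vector_derivative (A ** mexp (t *\<^sub>R A)) $ i $ j) (at t)"
    by simp
qed

lemma mexp_commute: "A ** B = B ** A \<Longrightarrow> A ** mexp B = mexp B ** A"
  by (rule mexp_intertwine)

text \<open>The product of the exponentials of tA, tB and -t(A + B) has zero derivative, hence has
  the same value at t = 1 as at t = 0. The inverse law is proved by the same argument beforehand,
  because it is needed to cancel the third factor.\<close>

lemma mexp_add_commuting:
  assumes "A ** B = B ** A"
  shows "mexp A ** mexp B = mexp (A + B)"
proof -
  have inverse: "mexp C ** mexp (- C) = mat 1" for C :: "complex^'n^'n"
  proof -
    define g where "g t = mexp (t *\<^sub>R C) ** mexp (t *\<^sub>R (- C))" for t :: real
    have "(g has_derivative (\<lambda>_. 0)) (at t within UNIV)" for t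
    proof -
      have "C ** mexp (t *\<^sub>R C) = mexp (t *\<^sub>R C) ** C"
        by (rule mexp_commute) (simp add: matrix_simps)
      then have "mexp (t *\<^sub>R C) ** ((- C) ** mexp (t *\<^sub>R (- C)))
          + (C ** mexp (t *\<^sub>R C)) ** mexp (t *\<^sub>R (- C)) = 0"
        by (simp add: matrix_simps matrix_mul_assoc)
      then have "(g has_vector_derivative 0) (at t)"
        using has_vector_derivative_matrix_mult[OF mexp_has_vector_derivative[of C t]
            mexp_has_vector_derivative[of "- C" t]]
        by (simp add: g_def[abs_def])
      then show ?thesis
        by (simp add: has_vector_derivative_def)
    qed
    then obtain c where "\<And>t. g t = c"
      using has_derivative_zero_constant[of UNIV g] by auto
    from this[of 0] this[of 1] show ?thesis
      by (simp add: g_def)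
  qed
  define g where "g t = (mexp (t *\<^sub>R A) ** mexp (t *\<^sub>R B)) ** mexp (t *\<^sub>R (- (A + B)))" for t :: real
  have "(g has_derivative (\<lambda>_. 0)) (at t within UNIV)" for t
  proof -
    let ?a = "mexp (t *\<^sub>R A)" and ?b = "mexp (t *\<^sub>R B)" and ?c = "mexp (t *\<^sub>R (- (A + B)))"
    have b: "B ** ?b = ?b ** B" and a: "A ** ?b = ?b ** A" and c: "A ** ?a = ?a ** A"
      by (rule mexp_commute; simp add: matrix_simps assms)+
    have "(?a ** ?b) ** ((- (A + B)) ** ?c) + (?a ** (B ** ?b) + (A ** ?a) ** ?b) ** ?c = 0"
    proof -
      have "?a ** (?b ** (A ** ?c)) = A ** (?a ** (?b ** ?c))"
        by (simp only: matrix_mul_assoc c) (simp only: matrix_mul_assoc[symmetric] a)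
      moreover have "?a ** (B ** (?b ** ?c)) = ?a ** (?b ** (B ** ?c))"
        by (simp only: matrix_mul_assoc b)
      ultimately show ?thesis
        by (simp add: matrix_simps matrix_mul_assoc[symmetric])
    qed
    then have "(g has_vector_derivative 0) (at t)"
      using has_vector_derivative_matrix_mult[OF has_vector_derivative_matrix_mult[OF
            mexp_has_vector_derivative[of A t] mexp_has_vector_derivative[of B t]]
            mexp_has_vector_derivative[of "- (A + B)" t]]
      by (simp add: g_def[abs_def])
    then show ?thesis
      by (simp add: has_vector_derivative_def)
  qed
  then obtain c where "\<And>t. g t = c"
    using has_derivative_zero_constant[of UNIV g] by auto
  from this[of 0] this[of 1] have "(mexp A ** mexp B) ** mexp (- (A + B)) = mat 1"
    by (simp add: g_def)
  then have "(mexp A ** mexp B) ** (mexp (- (A + B)) ** mexp (A + B)) = mexp (A + B)"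
    by (simp add: matrix_mul_assoc)
  then show ?thesis
    using inverse[of "- (A + B)"] by (simp only: minus_minus matrix_mul_rid)
qed

lemma mexp_minus_right [simp]: "mexp A ** mexp (- A) = mat 1"
  and mexp_minus_left [simp]: "mexp (- A) ** mexp A = mat 1"
  by (simp_all add: mexp_add_commuting matrix_simps)

section \<open>Projectors and tangent vectors\<close>

lemma grass_metric_commute: "grass_metric A B = grass_metric B A"
  unfolding grass_metric_def by (subst trace_mul_sym) (rule refl)

lemma grass_metric_add_right: "grass_metric A (B + B') = grass_metric A B + grass_metric A B'"
  by (simp add: grass_metric_inner inner_right_distrib)

lemma GrassD:
  assumes "P \<in> Grass m"
  shows "hconj P = P" "P ** P = P" "trace P = of_nat m"
  using assms by (auto simp: Grass_def)

lemma idem_mult: "P ** P = P \<Longrightarrow> P ** (P ** X) = P ** X" for P X :: "complex^'n^'n"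
  by (simp add: matrix_mul_assoc)

text \<open>The equation Aq + qA = A says that both diagonal blocks of A with respect to the
  projector q vanish; this extracts the block on the range of q.\<close>

lemma offdiag_corner_zero:
  fixes A q :: "complex^'n^'n"
  assumes "q ** q = q" "A ** q + q ** A = A"
  shows "q ** A ** q = 0"
proof -
  have "q ** A = q ** (A ** q + q ** A)"
    by (simp add: assms(2))
  also have "\<dots> = q ** A ** q + q ** A"
    by (simp add: matrix_simps idem_mult[OF assms(1)] matrix_mul_assoc[symmetric])
  finally show ?thesis
    by simp
qed

text \<open>Linear equations replace the existential over \<Omega>, so that the tangent space is
  visibly a closed subspace. The witness is -[H,P], because taking the commutator with P twice is
  the identity on off-diagonal matrices.\<close>

lemma tangent_iff:
  fixes H P :: "complex^'n^'n"
  assumes P: "hconj P = P" "P ** P = P"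
  shows "H \<in> tangent P \<longleftrightarrow> hconj H = H \<and> H ** P + P ** H = H"
proof
  assume "H \<in> tangent P"
  then obtain \<Omega> where \<Omega>: "H = P ** \<Omega> - \<Omega> ** P" "hconj \<Omega> = - \<Omega>"
    by (auto simp: tangent_def)
  show "hconj H = H \<and> H ** P + P ** H = H"
    by (simp add: \<Omega> hconj_mult P matrix_simps idem_mult matrix_mul_assoc[symmetric])
next
  assume H: "hconj H = H \<and> H ** P + P ** H = H"
  have "P ** H ** P = 0"
    using offdiag_corner_zero[OF P(2)] H by simp
  then have "P ** (- comm H P) - (- comm H P) ** P = H ** P + P ** H"
    by (simp add: comm_def matrix_simps P idem_mult matrix_mul_assoc[symmetric])
  moreover have "hconj (- comm H P) = - (- comm H P)"
    by (simp add: comm_def hconj_mult H P)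
  ultimately show "H \<in> tangent P"
    unfolding tangent_def using H by (intro CollectI exI[of _ "- comm H P"]) simp
qed

lemma tangent_Grass_iff:
  "P \<in> Grass m \<Longrightarrow> H \<in> tangent P \<longleftrightarrow> hconj H = H \<and> H ** P + P ** H = H"
  using tangent_iff GrassD by blast

text \<open>On off-diagonal matrices the commutator with P is an involution that exchanges Hermitian
  and skew-Hermitian ones. Thus [H,P] is a skew-Hermitian off-diagonal generator whose flow starts
  with velocity H.\<close>

lemma tangentD:
  assumes "P \<in> Grass m" "H \<in> tangent P"
  shows "hconj H = H" "H ** P + P ** H = H" "P ** H ** P = 0"
    "hconj (comm H P) = - comm H P" "comm H P ** P + P ** comm H P = comm H P"
    "comm (comm H P) P = H"
proof -
  note P = GrassD[OF assms(1)]
  show H: "hconj H = H" "H ** P + P ** H = H"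
    using assms tangent_iff P by auto
  then show PHP: "P ** H ** P = 0"
    using offdiag_corner_zero[OF P(2)] by simp
  show "hconj (comm H P) = - comm H P"
    by (simp add: comm_def hconj_mult H P)
  show "comm H P ** P + P ** comm H P = comm H P"
    by (simp add: comm_def matrix_simps P idem_mult matrix_mul_assoc[symmetric])
  have "comm (comm H P) P = H ** P + P ** H"
    using PHP by (simp add: comm_def matrix_simps P idem_mult matrix_mul_assoc[symmetric])
  then show "comm (comm H P) P = H"
    by (simp add: H)
qed

lemma comm_skew_tangent:
  assumes "hconj A = - A"
  shows "comm A P \<in> tangent P"
proof -
  have "comm A P = P ** (- A) - (- A) ** P"
    by (simp add: comm_def matrix_simps)
  then show ?thesis
    unfolding tangent_def using assms by force
qed

lemma comm_skew_hermitian: "hconj A = - A \<Longrightarrow> hconj P = P \<Longrightarrow> hconj (comm A P) = comm A P"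
  by (simp add: comm_def hconj_mult matrix_simps)

lemma closed_tangent:
  fixes P :: "complex^'n^'n"
  assumes "P \<in> Grass m"
  shows "closed (tangent P)"
proof -
  have cont: "continuous_on UNIV (\<lambda>H. hconj H)"
    by (rule linear_continuous_on[OF bounded_linear_hconj])
  have "tangent P = {H. hconj H = H} \<inter> {H. H ** P + P ** H = H}"
    using tangent_iff GrassD[OF assms] by auto
  then show ?thesis
    by (intro closed_Int closed_Collect_eq continuous_intros cont |simp)+
qed

lemma mexp_cancel: "mexp (- A) ** (mexp A ** X) = X" "mexp A ** (mexp (- A) ** X) = X"
  for A X :: "complex^'n^'n"
  by (simp_all add: matrix_mul_assoc)

lemma trace_mexp_conj: "trace (mexp A ** X ** mexp (- A)) = trace X"
proof -
  have "trace (mexp A ** (X ** mexp (- A))) = trace ((X ** mexp (- A)) ** mexp A)"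
    by (rule trace_mul_sym)
  then show ?thesis
    by (simp add: matrix_mul_assoc[symmetric])
qed

lemma mexp_conj_mult:
  "(mexp A ** X ** mexp (- A)) ** (mexp A ** Y ** mexp (- A)) = mexp A ** (X ** Y) ** mexp (- A)"
  for A X Y :: "complex^'n^'n"
  by (simp add: matrix_mul_assoc[symmetric] mexp_cancel)

lemma grass_metric_mexp_conj:
  "grass_metric (mexp A ** X ** mexp (- A)) (mexp A ** Y ** mexp (- A)) = grass_metric X Y"
  by (simp add: grass_metric_def mexp_conj_mult trace_mexp_conj)

lemma hconj_mexp_conj:
  "hconj A = - A \<Longrightarrow> hconj (mexp A ** X ** mexp (- A)) = mexp A ** hconj X ** mexp (- A)"
  by (simp add: hconj_mult hconj_mexp matrix_mul_assoc)

lemma mexp_conj_Grass: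
  assumes "P \<in> Grass m" "hconj A = - A"
  shows "mexp A ** P ** mexp (- A) \<in> Grass m"
  using GrassD[OF assms(1)]
  by (simp add: Grass_def mexp_conj_mult trace_mexp_conj hconj_mexp_conj assms)

lemma mexp_conj_inverse: "mexp (- A) ** (mexp A ** X ** mexp (- A)) ** mexp A = X"
  for A X :: "complex^'n^'n"
  by (simp add: matrix_mul_assoc[symmetric] mexp_cancel)

text \<open>Conjugation by \<open>mexp A\<close> fixes A, so it carries the off-diagonal relation
  from Q to the conjugated projector, that is, along the whole geodesic.\<close>

lemma mexp_conj_offdiag:
  assumes "A ** Q + Q ** A = A"
  shows "A ** (mexp A ** Q ** mexp (- A)) + (mexp A ** Q ** mexp (- A)) ** A = A"
proof -
  have 1: "A ** mexp A = mexp A ** A"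
    by (rule mexp_commute) simp
  have 2: "A ** mexp (- A) = mexp (- A) ** A"
    by (rule mexp_commute) (simp add: matrix_simps)
  have "A ** (mexp A ** Q ** mexp (- A)) + (mexp A ** Q ** mexp (- A)) ** A
      = mexp A ** (A ** Q + Q ** A) ** mexp (- A)"
    by (simp add: matrix_simps matrix_mul_assoc 1) (simp add: matrix_mul_assoc[symmetric] 2)
  also have "\<dots> = mexp A ** (mexp (- A) ** A)"
    by (simp only: assms matrix_mul_assoc[symmetric] 2)
  finally show ?thesis
    by (simp add: matrix_mul_assoc)
qed

lemma trace_zero: "trace (0 :: complex^'n^'n) = 0"
  by (simp add: trace_def)

text \<open>In blocks, the commutator with q deletes the diagonal and flips the sign of one
  off-diagonal block. Since A has no diagonal blocks, the diagonal blocks of B contribute to neither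
  side; this is why B may be arbitrary.\<close>

lemma trace_comm_comm:
  fixes A B q :: "complex^'n^'n"
  assumes "q ** q = q" "A ** q + q ** A = A"
  shows "trace (comm A q ** comm B q) = - trace (A ** B)"
proof -
  have 0: "q ** (A ** q) = 0"
    using offdiag_corner_zero[OF assms] by (simp add: matrix_mul_assoc)
  have tr: "trace (A ** (q ** (B ** q))) = trace (q ** (A ** (q ** B)))"
    using trace_mul_sym[of "A ** (q ** B)" q] by (simp add: matrix_mul_assoc)
  have "q ** (A ** (q ** B)) = 0"
    using arg_cong[OF 0, of "\<lambda>X. X ** B"] by (simp add: matrix_mul_assoc matrix_zero_left)
  then have "trace (comm A q ** comm B q) = - trace ((A ** q + q ** A) ** B)
      + (trace (q ** (A ** B)) - trace (q ** (A ** (B ** q))))"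
    by (simp add: comm_def matrix_simps idem_mult assms(1) tr trace_add trace_sub trace_zero matrix_mul_assoc[symmetric])
  moreover have "trace (q ** (A ** (B ** q))) = trace (q ** (A ** B))"
    using trace_mul_sym[of "q ** (A ** B)" q] idem_mult[OF assms(1), of "A ** B"]
    by (simp add: matrix_mul_assoc)
  ultimately show ?thesis
    by (simp add: assms)
qed

lemma norm_Grass: "P \<in> Grass m \<Longrightarrow> (norm P)\<^sup>2 = m"
  using grass_metric_hermitian[of P] GrassD[of P m] by (simp add: grass_metric_def)

text \<open>Source of the constant \<open>4 * m\<close> in the distance estimates. It is uniform
  along a curve, since every rank m projector has squared Frobenius norm m.\<close>

lemma norm_comm_Grass_le:
  assumes "P \<in> Grass m"
  shows "(norm (comm \<Omega> P))\<^sup>2 \<le> 4 * m * (norm \<Omega>)\<^sup>2"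
proof -
  have "(norm (comm \<Omega> P))\<^sup>2 \<le> (2 * norm \<Omega> * norm P)\<^sup>2"
    by (intro power_mono norm_comm_le) simp
  then show ?thesis
    by (simp add: power_mult_distrib norm_Grass[OF assms] mult_ac)
qed

section \<open>Lengths of curves\<close>

text \<open>The one-parameter group of \<open>A\<close> moves \<open>Q\<close> along a geodesic, while the one of \<open>\<Omega>\<close> drags
  the endpoint away. The cross term of the squared speed turns out to be constant in \<open>t\<close>.\<close>

definition variation :: "complex^'n^'n \<Rightarrow> complex^'n^'n \<Rightarrow> complex^'n^'n \<Rightarrow> real \<Rightarrow> complex^'n^'n" where
  "variation \<Omega> A Q t =
     mexp (t *\<^sub>R \<Omega>) ** (mexp (t *\<^sub>R A) ** Q ** mexp (- (t *\<^sub>R A))) ** mexp (- (t *\<^sub>R \<Omega>))"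

lemma geodesic_eq_variation: "geodesic Q H = variation 0 (comm H Q) Q"
  by (simp add: geodesic_def variation_def fun_eq_iff)

text \<open>The generator is written inside the conjugation, so that invariance of the metric
  removes the outer exponentials.\<close>

lemma has_vector_derivative_mexp_conj:
  assumes "(q has_vector_derivative q') (at t)"
  shows "((\<lambda>t. mexp (t *\<^sub>R A) ** q t ** mexp (- (t *\<^sub>R A))) has_vector_derivative
    mexp (t *\<^sub>R A) ** (comm A (q t) + q') ** mexp (- (t *\<^sub>R A))) (at t)"
proof -
  have 1: "A ** mexp (t *\<^sub>R A) = mexp (t *\<^sub>R A) ** A"
    by (rule mexp_commute) (simp add: matrix_simps)
  have "((\<lambda>t. (mexp (t *\<^sub>R A) ** q t) ** mexp (t *\<^sub>R (- A))) has_vector_derivative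
     (mexp (t *\<^sub>R A) ** q t) ** ((- A) ** mexp (t *\<^sub>R (- A)))
     + (mexp (t *\<^sub>R A) ** q' + (A ** mexp (t *\<^sub>R A)) ** q t) ** mexp (t *\<^sub>R (- A))) (at t)"
    by (intro has_vector_derivative_matrix_mult mexp_has_vector_derivative assms)
  then show ?thesis
    by (simp add: comm_def 1 matrix_simps matrix_mul_assoc algebra_simps)
qed

lemma variation_has_vector_derivative:
  fixes \<Omega> A Q :: "complex^'n^'n"
  defines "q \<equiv> \<lambda>t. mexp (t *\<^sub>R A) ** Q ** mexp (- (t *\<^sub>R A))"
  shows "(variation \<Omega> A Q has_vector_derivative
    mexp (t *\<^sub>R \<Omega>) ** comm (\<Omega> + A) (q t) ** mexp (- (t *\<^sub>R \<Omega>))) (at t)"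
proof -
  have 1: "A ** mexp (t *\<^sub>R A) = mexp (t *\<^sub>R A) ** A"
    and 2: "A ** mexp (- (t *\<^sub>R A)) = mexp (- (t *\<^sub>R A)) ** A"
    by (rule mexp_commute; simp add: matrix_simps)+
  have "comm A (q t) = mexp (t *\<^sub>R A) ** (comm A Q + 0) ** mexp (- (t *\<^sub>R A))"
    by (simp add: q_def comm_def matrix_simps matrix_mul_assoc 1)
      (simp add: matrix_mul_assoc[symmetric] 2)
  then have "(q has_vector_derivative comm A (q t)) (at t)"
    using has_vector_derivative_mexp_conj[of "\<lambda>_. Q" 0 t A] by (simp add: q_def)
  from has_vector_derivative_mexp_conj[OF this, of \<Omega>] show ?thesis
    by (simp add: variation_def[abs_def] q_def comm_add_left)
qed

lemma continuous_on_variation_derivative: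
  "continuous_on S (\<lambda>t. mexp (t *\<^sub>R \<Omega>) ** comm B (mexp (t *\<^sub>R A) ** Q ** mexp (- (t *\<^sub>R A)))
     ** mexp (- (t *\<^sub>R \<Omega>)))"
  unfolding comm_def
  by (intro continuous_intros continuous_on_compose2[OF continuous_on_mexp[of UNIV]]) auto

lemma variation_Grass:
  assumes "Q \<in> Grass m" "hconj \<Omega> = - \<Omega>" "hconj A = - A"
  shows "variation \<Omega> A Q t \<in> Grass m"
  unfolding variation_def using assms by (intro mexp_conj_Grass) auto

text \<open>By invariance the squared speed is that of [\<Omega> + A, q]. Expanding the square,
  \<open>trace_comm_comm\<close> evaluates both terms that contain A, and only the term in
  [\<Omega>,q] still depends on t. Nonnegativity is stated separately because \<open>sqrt\<close> is
  odd, so the sign of the speed has to come from the Hermitian velocity.\<close>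

lemma speed_variation:
  assumes Q: "Q \<in> Grass m" and skew: "hconj \<Omega> = - \<Omega>" "hconj A = - A"
    and A: "A ** Q + Q ** A = A"
  shows "(speed (variation \<Omega> A Q) t)\<^sup>2 = - grass_metric A A - 2 * grass_metric A \<Omega>
      + (norm (comm \<Omega> (mexp (t *\<^sub>R A) ** Q ** mexp (- (t *\<^sub>R A)))))\<^sup>2"
    and "speed (variation \<Omega> A Q) t \<ge> 0"
proof -
  define q where "q = mexp (t *\<^sub>R A) ** Q ** mexp (- (t *\<^sub>R A))"
  have q: "q \<in> Grass m"
    unfolding q_def using Q skew by (intro mexp_conj_Grass) auto
  have "t *\<^sub>R A ** q + q ** t *\<^sub>R A = t *\<^sub>R A"
    unfolding q_def by (rule mexp_conj_offdiag) (use A in \<open>simp add: matrix_simps flip: scaleR_add_right\<close>)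
  have Aq: "A ** q + q ** A = A"
  \<comment> \<open>The off-diagonal relation is available for tA and is divided by t; at t = 0 the
    projector is Q itself.\<close>
  proof (cases "t = 0")
    case False
    then show ?thesis
      using \<open>t *\<^sub>R A ** q + q ** t *\<^sub>R A = t *\<^sub>R A\<close>
      by (simp add: matrix_simps flip: scaleR_add_right)
  qed (simp add: q_def A)
  have skew': "hconj (\<Omega> + A) = - (\<Omega> + A)"
    by (simp add: skew)
  have metric: "grass_metric (vector_derivative (variation \<Omega> A Q) (at t))
      (vector_derivative (variation \<Omega> A Q) (at t)) = grass_metric (comm (\<Omega> + A) q) (comm (\<Omega> + A) q)"
    unfolding vector_derivative_at[OF variation_has_vector_derivative]
    by (simp add: grass_metric_mexp_conj q_def)
  then have nonneg: "grass_metric (vector_derivative (variation \<Omega> A Q) (at t))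
      (vector_derivative (variation \<Omega> A Q) (at t)) \<ge> 0"
    using grass_metric_hermitian[OF comm_skew_hermitian[OF skew' GrassD(1)[OF q]]] by simp
  then show "speed (variation \<Omega> A Q) t \<ge> 0"
    by (simp add: speed_def)
  have cross: "grass_metric (comm A q) (comm B q) = - grass_metric A B" for B
    using trace_comm_comm[OF GrassD(2)[OF q] Aq] by (simp add: grass_metric_def)
  have "(speed (variation \<Omega> A Q) t)\<^sup>2 = grass_metric (comm (\<Omega> + A) q) (comm (\<Omega> + A) q)"
    using nonneg metric by (simp add: speed_def)
  also have "\<dots> = grass_metric (comm \<Omega> q) (comm \<Omega> q) + 2 * grass_metric (comm A q) (comm \<Omega> q)
      + grass_metric (comm A q) (comm A q)"
    using grass_metric_commute[of "comm \<Omega> q" "comm A q"]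
    by (simp add: comm_add_left grass_metric_add grass_metric_add_right)
  also have "\<dots> = (norm (comm \<Omega> q))\<^sup>2 - 2 * grass_metric A \<Omega> - grass_metric A A"
    unfolding cross grass_metric_hermitian[OF comm_skew_hermitian[OF skew(1) GrassD(1)[OF q]]]
    by simp
  finally show "(speed (variation \<Omega> A Q) t)\<^sup>2 = - grass_metric A A - 2 * grass_metric A \<Omega>
      + (norm (comm \<Omega> (mexp (t *\<^sub>R A) ** Q ** mexp (- (t *\<^sub>R A)))))\<^sup>2"
    by (simp add: q_def)
qed

section \<open>Admissible curves and the Riemannian distance\<close>

lemma connecting_curve_variation:
  assumes "Q \<in> Grass m" "hconj \<Omega> = - \<Omega>" "hconj A = - A"
  shows "connecting_curve m Q (variation \<Omega> A Q 1) (variation \<Omega> A Q)"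
  unfolding connecting_curve_def
proof (intro conjI)
  have deriv: "vector_derivative (variation \<Omega> A Q) (at t) = mexp (t *\<^sub>R \<Omega>) **
      comm (\<Omega> + A) (mexp (t *\<^sub>R A) ** Q ** mexp (- (t *\<^sub>R A))) ** mexp (- (t *\<^sub>R \<Omega>))" for t
    by (rule vector_derivative_at[OF variation_has_vector_derivative])
  have cont: "continuous_on {0..1} (\<lambda>t. vector_derivative (variation \<Omega> A Q) (at t))"
    unfolding deriv by (rule continuous_on_variation_derivative)
  have "variation \<Omega> A Q differentiable at t" for t
    using variation_has_vector_derivative by (rule differentiableI_vector)
  then have "variation \<Omega> A Q C1_differentiable_on {0..1}"
    using cont by (simp add: C1_differentiable_on_eq)
  then show "valid_path (variation \<Omega> A Q)"
    by (simp add: valid_path_def C1_differentiable_imp_piecewise)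
  show "path_image (variation \<Omega> A Q) \<subseteq> Grass m"
    using variation_Grass[OF assms] by (auto simp: path_image_def)
  show "pathstart (variation \<Omega> A Q) = Q"
    by (simp add: pathstart_def variation_def)
  show "pathfinish (variation \<Omega> A Q) = variation \<Omega> A Q 1"
    by (simp add: pathfinish_def)
  show "speed (variation \<Omega> A Q) integrable_on {0..1}"
    unfolding speed_def[abs_def] grass_metric_inner
    by (intro integrable_continuous_real continuous_intros cont
        bounded_linear.continuous_on[OF bounded_linear_hconj])
qed

text \<open>Conjugate transposition is linear and fixes the curve near t, hence fixes its
  derivative. An open set around t is required because the derivative is two-sided.\<close>

lemma vector_derivative_hermitian:
  assumes "\<gamma> differentiable at t" "open S" "t \<in> S" "\<And>s. s \<in> S \<Longrightarrow> \<gamma> s \<in> Grass m"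
  shows "hconj (vector_derivative \<gamma> (at t)) = vector_derivative \<gamma> (at t)"
proof -
  have D: "(\<gamma> has_vector_derivative vector_derivative \<gamma> (at t)) (at t)"
    using assms(1) by (simp add: vector_derivative_works)
  have "((\<lambda>s. hconj (\<gamma> s)) has_vector_derivative hconj (vector_derivative \<gamma> (at t))) (at t)"
    by (rule bounded_linear.has_vector_derivative[OF bounded_linear_hconj D])
  then have "(\<gamma> has_vector_derivative hconj (vector_derivative \<gamma> (at t))) (at t)"
    by (rule has_vector_derivative_transform_within_open[OF _ assms(2,3)])
      (use assms(4) GrassD in blast)
  then show ?thesis
    by (rule vector_derivative_unique_at[OF _ D])
qed

lemma connecting_curve_differentiable:
  assumes "connecting_curve m P Q \<gamma>"
  obtains S where "finite S" "\<And>t. t \<in> {0..1} - S \<Longrightarrow> \<gamma> differentiable at t"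
proof -
  from assms obtain S where "finite S" "\<gamma> C1_differentiable_on {0..1} - S"
    by (auto simp: connecting_curve_def valid_path_def piecewise_C1_differentiable_on_def)
  then show ?thesis
    using that by (auto simp: C1_differentiable_on_eq)
qed

text \<open>\<open>speed\<close> can be negative where the derivative is a junk value, since \<open>sqrt\<close> is odd.\<close>

lemma curve_length_nonneg:
  assumes "connecting_curve m P Q \<gamma>"
  shows "curve_length \<gamma> \<ge> 0"
proof -
  obtain S where S: "finite S" "\<And>t. t \<in> {0..1} - S \<Longrightarrow> \<gamma> differentiable at t"
    using connecting_curve_differentiable[OF assms] by blast
  \<comment> \<open>The endpoints are discarded along with the exceptional points: outside [0,1] the
    curve may leave the Grassmannian, so its two-sided derivatives at 0 and 1 are
    uncontrolled.\<close>
  define g where "g t = (if t \<in> insert 0 (insert 1 S) then 0 else speed \<gamma> t)" for t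
  have "(speed \<gamma> has_integral curve_length \<gamma>) {0..1}"
    using assms by (auto simp: connecting_curve_def curve_length_def)
  then have g: "(g has_integral curve_length \<gamma>) {0..1}"
    by (rule has_integral_spike_finite[of "insert 0 (insert 1 S)", rotated 2])
      (use S(1) in \<open>auto simp: g_def\<close>)
  have "g t \<ge> 0" if "t \<in> {0..1}" for t
  proof (cases "t \<in> insert 0 (insert 1 S)")
    case False
    have "hconj (vector_derivative \<gamma> (at t)) = vector_derivative \<gamma> (at t)"
    proof (rule vector_derivative_hermitian)
      show "\<gamma> differentiable at t"
        using S False that by auto
      show "t \<in> {0<..<1}"
        using False that by auto
      show "\<gamma> s \<in> Grass m" if "s \<in> {0<..<1}" for s
        using assms that by (auto simp: connecting_curve_def path_image_def)
    qed auto
    then show ?thesis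
      using False by (simp add: g_def speed_def grass_metric_hermitian)
  qed (simp add: g_def)
  then show ?thesis
    using has_integral_nonneg[OF g] by blast
qed

lemma grass_dist_le: "connecting_curve m P Q \<gamma> \<Longrightarrow> grass_dist m P Q \<le> curve_length \<gamma>"
  unfolding grass_dist_def
  by (rule cInf_lower) (auto intro!: bdd_belowI[of _ 0] curve_length_nonneg)

lemma grass_dist_nonneg:
  assumes "connecting_curve m P Q \<gamma>"
  shows "grass_dist m P Q \<ge> 0"
  unfolding grass_dist_def using assms
  by (intro cInf_greatest) (auto intro: curve_length_nonneg)

text \<open>Gives the symmetry of the distance. \<open>karcher_mean_fun\<close> measures from P,
  whereas the velocities \<xi> start at the points Q i.\<close>

lemma connecting_curve_reversepath:
  assumes "connecting_curve m P Q \<gamma>"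
  shows "connecting_curve m Q P (reversepath \<gamma>)" "curve_length (reversepath \<gamma>) = curve_length \<gamma>"
proof -
  obtain S where S: "finite S" "\<And>t. t \<in> {0..1} - S \<Longrightarrow> \<gamma> differentiable at t"
    using connecting_curve_differentiable[OF assms] by blast
  have "(speed \<gamma> has_integral curve_length \<gamma>) (cbox 0 1)"
    using assms by (auto simp: connecting_curve_def curve_length_def)
  from has_integral_affinity[OF this, of "- 1" 1]
  have "((\<lambda>t. speed \<gamma> (1 - t)) has_integral curve_length \<gamma>) ((\<lambda>x. 1 - x) ` {0..1})"
    by simp
  moreover have "(\<lambda>x. 1 - x) ` {0..1 :: real} = {0..1}"
    by (simp)
  ultimately have int: "((\<lambda>t. speed \<gamma> (1 - t)) has_integral curve_length \<gamma>) {0..1}"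
    by simp
  have speed: "speed (reversepath \<gamma>) t = speed \<gamma> (1 - t)" if "t \<in> {0..1} - (\<lambda>s. 1 - s) ` S" for t
  proof -
    have "1 - t \<notin> S"
      using that by force
    then have "(\<gamma> has_vector_derivative vector_derivative \<gamma> (at (1 - t))) (at (1 - t))"
      using S that by (simp add: vector_derivative_works[symmetric])
    then have "((\<gamma> \<circ> (\<lambda>s. 1 - s)) has_vector_derivative (- 1) *\<^sub>R vector_derivative \<gamma> (at (1 - t))) (at t)"
      by (intro vector_diff_chain_at) (auto intro!: derivative_eq_intros)
    then have "vector_derivative (reversepath \<gamma>) (at t) = - vector_derivative \<gamma> (at (1 - t))"
      by (intro vector_derivative_at) (simp add: reversepath_def o_def)
    then show ?thesis
      by (simp add: speed_def grass_metric_inner)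
  qed
  have rev: "(speed (reversepath \<gamma>) has_integral curve_length \<gamma>) {0..1}"
    by (rule has_integral_spike_finite[OF _ speed int]) (use S in auto)
  then show "curve_length (reversepath \<gamma>) = curve_length \<gamma>"
    by (simp add: curve_length_def integral_unique)
  show "connecting_curve m Q P (reversepath \<gamma>)"
    using assms rev valid_path_imp_reverse by (auto simp: connecting_curve_def)
qed

lemma grass_dist_commute: "grass_dist m P Q = grass_dist m Q P"
proof -
  have "{curve_length \<gamma> |\<gamma>. connecting_curve m P Q \<gamma>} \<subseteq> {curve_length \<gamma> |\<gamma>. connecting_curve m Q P \<gamma>}"
    for P Q :: "complex^'n^'n"
    using connecting_curve_reversepath by fastforce
  then show ?thesis
    unfolding grass_dist_def by (intro arg_cong[where f = Inf] subset_antisym)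
qed

text \<open>The right-hand side dominates the squared speed of \<open>variation\<close> at every t,
  so its square root dominates the length. The geodesic part contributes -tr(A^2), which is the
  squared norm of \<xi> = [A,Q].\<close>

lemma grass_dist_variation_le:
  assumes Q: "Q \<in> Grass m" and \<xi>: "\<xi> \<in> tangent Q" and \<Omega>: "hconj \<Omega> = - \<Omega>"
  defines "A \<equiv> comm \<xi> Q"
  shows "(grass_dist m Q (mexp \<Omega> ** riem_exp Q \<xi> ** mexp (- \<Omega>)))\<^sup>2
    \<le> (norm \<xi>)\<^sup>2 - 2 * grass_metric A \<Omega> + 4 * m * (norm \<Omega>)\<^sup>2"
proof -
  have A: "hconj A = - A" "A ** Q + Q ** A = A" "comm A Q = \<xi>"
    using tangentD[OF Q \<xi>] by (auto simp: A_def)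
  define b where "b = (norm \<xi>)\<^sup>2 - 2 * grass_metric A \<Omega> + 4 * m * (norm \<Omega>)\<^sup>2"
  have conn: "connecting_curve m Q (mexp \<Omega> ** riem_exp Q \<xi> ** mexp (- \<Omega>)) (variation \<Omega> A Q)"
    using connecting_curve_variation[OF Q \<Omega> A(1)] by (simp add: variation_def riem_exp_def geodesic_def A_def)
  have "(norm \<xi>)\<^sup>2 = - grass_metric A A"
    using trace_comm_comm[OF GrassD(2)[OF Q] A(2), of A] grass_metric_hermitian[of \<xi>] tangentD[OF Q \<xi>] A(3)
    by (simp add: grass_metric_def)
  then have sq: "(speed (variation \<Omega> A Q) t)\<^sup>2 \<le> b" for t
    using speed_variation(1)[OF Q \<Omega> A(1,2), of t]
      norm_comm_Grass_le[OF mexp_conj_Grass[OF Q, of "t *\<^sub>R A"], of \<Omega>] A(1)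
    by (simp add: b_def)
  then have b: "b \<ge> 0"
    using order_trans[OF zero_le_power2] by blast
  have "curve_length (variation \<Omega> A Q) \<le> integral {0..1 :: real} (\<lambda>_. sqrt b)"
    unfolding curve_length_def
    by (rule integral_le) (use conn sq in \<open>auto simp: connecting_curve_def intro: real_le_rsqrt\<close>)
  then have "grass_dist m Q (mexp \<Omega> ** riem_exp Q \<xi> ** mexp (- \<Omega>)) \<le> sqrt b"
    using grass_dist_le[OF conn] by simp
  then have "(grass_dist m Q (mexp \<Omega> ** riem_exp Q \<xi> ** mexp (- \<Omega>)))\<^sup>2 \<le> (sqrt b)\<^sup>2"
    using grass_dist_nonneg[OF conn] by (rule power_mono)
  then show ?thesis
    using b by (simp add: b_def)
qed

lemma grass_dist_riem_exp_le:
  assumes "Q \<in> Grass m" "\<xi> \<in> tangent Q"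
  shows "grass_dist m Q (riem_exp Q \<xi>) \<ge> 0" "grass_dist m Q (riem_exp Q \<xi>) \<le> norm \<xi>"
proof -
  have "connecting_curve m Q (riem_exp Q \<xi>) (variation 0 (comm \<xi> Q) Q)"
    using connecting_curve_variation[OF assms(1), of 0 "comm \<xi> Q"] tangentD[OF assms]
    by (simp add: riem_exp_def geodesic_eq_variation)
  then show "grass_dist m Q (riem_exp Q \<xi>) \<ge> 0"
    by (rule grass_dist_nonneg)
  show "grass_dist m Q (riem_exp Q \<xi>) \<le> norm \<xi>"
    using grass_dist_variation_le[OF assms, of 0]
    by (intro power2_le_imp_le[OF _ norm_ge_zero]) (simp add: grass_metric_inner)
qed

text \<open>The curve agrees with the geodesic on [0,1] only, so the two-sided derivatives are
  compared at interior points and the endpoints are dropped as a null set.\<close>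

lemma curve_length_geodesic:
  assumes Q: "Q \<in> Grass m" and H: "H \<in> tangent Q" and \<gamma>: "\<And>t. t \<in> {0..1} \<Longrightarrow> \<gamma> t = geodesic Q H t"
  shows "curve_length \<gamma> = norm H"
proof -
  define A where "A = comm H Q"
  have A: "hconj A = - A" "A ** Q + Q ** A = A" "comm A Q = H"
    using tangentD[OF Q H] by (auto simp: A_def)
  have norm: "(norm H)\<^sup>2 = - grass_metric A A"
    using trace_comm_comm[OF GrassD(2)[OF Q] A(2), of A] grass_metric_hermitian[of H] tangentD[OF Q H] A(3)
    by (simp add: grass_metric_def)
  have *: "speed (variation 0 A Q) t = norm H" for t
  proof (rule power2_eq_imp_eq)
    have 0: "hconj 0 = - (0 :: complex^'n^'n)"
      by simp
    show "(speed (variation 0 A Q) t)\<^sup>2 = (norm H)\<^sup>2"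
      unfolding speed_variation(1)[OF Q 0 A(1,2)] norm
      by (simp add: comm_0_left grass_metric_inner)
    show "speed (variation 0 A Q) t \<ge> 0"
      by (rule speed_variation(2)[OF Q 0 A(1,2)])
  qed simp
  have speed: "speed \<gamma> t = norm H" if "t \<in> {0..1} - {0, 1}" for t
  proof -
    have "(\<gamma> has_vector_derivative vector_derivative (variation 0 A Q) (at t)) (at t)"
    proof (rule has_vector_derivative_transform_within_open[of "variation 0 A Q" _ _ "{0<..<1}"])
      show "(variation 0 A Q has_vector_derivative vector_derivative (variation 0 A Q) (at t)) (at t)"
        unfolding vector_derivative_works[symmetric]
        by (rule differentiableI_vector[OF variation_has_vector_derivative])
      show "variation 0 A Q s = \<gamma> s" if "s \<in> {0<..<1}" for s
        using \<gamma>[of s] that by (simp add: geodesic_eq_variation A_def)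
    qed (use that in auto)
    from vector_derivative_at[OF this] have "speed \<gamma> t = speed (variation 0 A Q) t"
      by (simp add: speed_def)
    then show ?thesis
      using * by simp
  qed
  have "integral {0..1} (speed \<gamma>) = integral {0..1} (\<lambda>_ :: real. norm H)"
    by (rule integral_spike[of "{0, 1}"]) (use speed in auto)
  then show ?thesis
    by (simp add: curve_length_def)
qed

lemma geodesic_has_vector_derivative_0:
  assumes "Q \<in> Grass m" "H \<in> tangent Q"
  shows "(geodesic Q H has_vector_derivative H) (at 0)"
  using variation_has_vector_derivative[of 0 "comm H Q" Q 0] tangentD(6)[OF assms]
  by (simp add: geodesic_eq_variation)

section \<open>The local logarithm\<close>

text \<open>Origin of the radius 1/4: there exp(1/4) - 1 is at most 1/4 + 1/16, below the
  contraction factor 1/2.\<close>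

lemma mexp_remainder_lipschitz:
  assumes "norm A \<le> 1/4" "norm B \<le> 1/4"
  shows "norm (mexp A - mexp B - (A - B)) \<le> 1/2 * norm (A - B)"
proof -
  have "exp (1/4) - 1 \<le> (1/2 :: real)"
    using exp_bound[of "1/4"] by (simp add: power2_eq_square)
  then have "(exp (1/4) - 1) * norm (A - B) \<le> 1/2 * norm (A - B)"
    by (rule mult_right_mono) simp
  then show ?thesis
    using mexp_lipschitz(2)[OF assms] by linarith
qed

lemma mexp_remainder_le:
  assumes "norm A \<le> 1"
  shows "norm (mexp A - mat 1 - A) \<le> 2 * (norm A)\<^sup>2"
proof -
  have "norm (mexp A - mat 1 - A) \<le> (exp (norm A) - 1) * norm A"
    using mexp_lipschitz(2)[of A "norm A" 0] by simp
  also have "\<dots> \<le> (norm A + (norm A)\<^sup>2) * norm A"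
    using exp_bound[of "norm A"] assms by (intro mult_right_mono) auto
  also have "\<dots> \<le> (norm A + norm A) * norm A"
    using mult_left_mono[OF assms, of "norm A"]
    by (intro mult_right_mono add_left_mono) (auto simp: power2_eq_square)
  finally show ?thesis
    by (simp add: power2_eq_square)
qed

text \<open>Equal exponentials would make the norm of A - B at most half of itself. This transfers
  symmetries of an exponential to its exponent.\<close>

lemma mexp_inj_near_0:
  assumes "norm A \<le> 1/4" "norm B \<le> 1/4" "mexp A = mexp B"
  shows "A = B"
  using mexp_remainder_lipschitz[OF assms(1,2)] assms(3) by (simp add: norm_minus_commute)

text \<open>A logarithm of U is a fixed point of \<open>f\<close>, a contraction by 1/2. The ball of
  radius 1/4 is preserved because \<open>f 0\<close> has norm at most 1/8 and the contraction adds
  at most another 1/8.\<close>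

lemma mexp_surj_near_1:
  fixes U :: "complex^'n^'n"
  assumes "norm (U - mat 1) \<le> 1/8"
  obtains A where "mexp A = U" "norm A \<le> 1/4" "norm A \<le> 2 * norm (U - mat 1)"
proof -
  define f where "f A = U - (mexp A - A)" for A
  have lip: "norm (f A - f B) \<le> 1/2 * norm (A - B)" if "norm A \<le> 1/4" "norm B \<le> 1/4" for A B
    using mexp_remainder_lipschitz[OF that]
      norm_minus_cancel[of "mexp A - mexp B - (A - B)"]
    by (simp add: f_def algebra_simps)
  have f0: "f 0 = U - mat 1"
    by (simp add: f_def)
  have "\<exists>!A. A \<in> cball 0 (1/4) \<and> f A = A"
  proof (rule Banach_fix)
    show "f ` cball 0 (1/4) \<subseteq> cball 0 (1/4)"
    proof safe
      fix A :: "complex^'n^'n"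
      assume "A \<in> cball 0 (1/4)"
      then have "norm (f A - f 0) \<le> 1/2 * norm A" "norm A \<le> 1/4"
        using lip[of A 0] by auto
      moreover have "norm (f A) \<le> norm (f A - f 0) + norm (f 0)"
        using norm_triangle_ineq[of "f A - f 0" "f 0"] by simp
      ultimately show "f A \<in> cball 0 (1/4)"
        using assms by (simp add: f0)
    qed
    show "dist (f A) (f B) \<le> 1/2 * dist A B" if "A \<in> cball 0 (1/4)" "B \<in> cball 0 (1/4)" for A B
      using lip[of A B] that by (simp add: dist_norm)
  qed (auto simp: complete_eq_closed)
  then obtain A where A: "norm A \<le> 1/4" "f A = A"
    by auto
  moreover have "norm A \<le> norm (f A - f 0) + norm (f 0)"
    using norm_triangle_ineq[of "f A - f 0" "f 0"] A by simp
  ultimately have "norm A \<le> 2 * norm (U - mat 1)"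
    using lip[of A 0] by (simp add: f0)
  then show ?thesis
    using that A by (auto simp: f_def)
qed

lemma reflection_Grass:
  assumes "P \<in> Grass m"
  shows "(2 *\<^sub>R P - mat 1) ** (2 *\<^sub>R P - mat 1) = mat 1" "hconj (2 *\<^sub>R P - mat 1) = 2 *\<^sub>R P - mat 1"
proof -
  define A where "A = 2 *\<^sub>R P"
  have "A ** A = A + A"
    by (simp only: A_def matrix_simps GrassD[OF assms] scaleR_2[of "2 *\<^sub>R P"])
  then have "(A - mat 1) ** (A - mat 1) = mat 1"
    by (simp add: matrix_diff_ldistrib matrix_diff_rdistrib)
  then show "(2 *\<^sub>R P - mat 1) ** (2 *\<^sub>R P - mat 1) = mat 1"
    by (simp add: A_def)
  show "hconj (2 *\<^sub>R P - mat 1) = 2 *\<^sub>R P - mat 1"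
    by (simp add: GrassD[OF assms])
qed

text \<open>With the reflections \<open>J = 2P - 1\<close> and \<open>J' = 2P' - 1\<close>, half the logarithm of \<open>J'J\<close> is
  skew-Hermitian and anticommutes with \<open>J\<close>, so its exponential conjugates \<open>J\<close> to \<open>J'\<close>.\<close>

lemma Grass_local_log:
  fixes P :: "complex^'n^'n"
  assumes P: "P \<in> Grass m"
  obtains \<delta> C where "0 < \<delta>" "\<delta> \<le> 1" "0 \<le> C"
    "\<forall>P'\<in>Grass m. norm (P' - P) < \<delta> \<longrightarrow> (\<exists>\<Omega>. hconj \<Omega> = - \<Omega> \<and>
       mexp \<Omega> ** P ** mexp (- \<Omega>) = P' \<and> norm \<Omega> \<le> C * norm (P' - P) \<and>
       norm (\<Omega> - comm (P' - P) P) \<le> C * (norm (P' - P))\<^sup>2)"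
proof -
  define J where "J = 2 *\<^sub>R P - mat 1"
  define j where "j = norm J"
  \<comment> \<open>The cube dominates 1, j and j^3. With j it brings U within 1/8 of the identity,
    where a logarithm X exists; with j^3 it keeps JXJ within the radius 1/4 of injectivity. In C,
    the part 16 j^2 + 1 bounds the quadratic remainder and 2 |P| accounts for the commutator
    [D,P].\<close>
  define \<delta> where "\<delta> = 1 / (16 * (1 + j) ^ 3)"
  define C where "C = 16 * j\<^sup>2 + 1 + 2 * norm P"
  have j: "j \<ge> 0"
    by (simp add: j_def)
  have JJ: "J ** J = mat 1" and hJ: "hconj J = J"
    using reflection_Grass[OF P] by (simp_all add: J_def)
  have pow: "1 \<le> (1 + j) ^ 3" "j \<le> (1 + j) ^ 3" "j * j * j \<le> (1 + j) ^ 3"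
    using j by (auto simp: power3_eq_cube algebra_simps add_increasing)
  have \<delta>: "0 < \<delta>" "\<delta> \<le> 1"
  proof -
    have *: "1 \<le> 16 * (1 + j) ^ 3"
      using pow(1) by linarith
    then have "0 < 16 * (1 + j) ^ 3"
      by linarith
    then show "0 < \<delta>"
      unfolding \<delta>_def by (rule divide_pos_pos[OF zero_less_one])
    show "\<delta> \<le> 1"
      unfolding \<delta>_def using * \<open>0 < 16 * (1 + j) ^ 3\<close> by (simp only: divide_le_eq_1_pos)
  qed
  have \<delta>j: "16 * (\<delta> * j) \<le> 1" "16 * (\<delta> * (j * j * j)) \<le> 1"
    using pow j by (simp_all add: \<delta>_def divide_simps)
  have "0 \<le> C"
    by (simp add: C_def)
  have main: "\<exists>\<Omega>. hconj \<Omega> = - \<Omega> \<and> mexp \<Omega> ** P ** mexp (- \<Omega>) = P' \<and>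
      norm \<Omega> \<le> C * norm (P' - P) \<and> norm (\<Omega> - comm (P' - P) P) \<le> C * (norm (P' - P))\<^sup>2"
    if P': "P' \<in> Grass m" and close: "norm (P' - P) < \<delta>" for P'
  proof -
    define D where "D = P' - P"
    define J' where "J' = 2 *\<^sub>R P' - mat 1"
    define U where "U = J' ** J"
    have J'J': "J' ** J' = mat 1" and hJ': "hconj J' = J'"
      using reflection_Grass[OF P'] by (simp_all add: J'_def)
    have U1: "U - mat 1 = 2 *\<^sub>R (D ** J)"
    proof -
      have "U - mat 1 = (J' - J) ** J"
        by (simp add: U_def matrix_simps JJ)
      also have "J' - J = 2 *\<^sub>R D"
        by (simp add: J'_def J_def D_def scaleR_diff_right)
      finally show ?thesis
        by (simp add: matrix_simps)
    qed
    have D: "norm D < \<delta>"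
      using close by (simp add: D_def)
    have normU: "norm (U - mat 1) \<le> 2 * (norm D * j)"
      using norm_matrix_mult[of D J] by (simp add: U1 j_def)
    have "norm D * j \<le> \<delta> * j"
      using D j by (intro mult_right_mono) auto
    then have "norm (U - mat 1) \<le> 1/8"
      using normU \<delta>j by linarith
    then obtain X where X: "mexp X = U" "norm X \<le> 1/4" "norm X \<le> 2 * norm (U - mat 1)"
      by (rule mexp_surj_near_1)
    have normX: "norm X \<le> 4 * (norm D * j)"
      using X(3) normU by linarith
    have minus: "mexp (- X) = J ** J'"
    proof -
      have "mexp (- X) = (J ** (J' ** J') ** J) ** mexp (- X)"
        by (simp add: J'J' JJ)
      also have "\<dots> = J ** J' ** (mexp X ** mexp (- X))"
        by (simp only: X(1) U_def matrix_mul_assoc)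
      finally show ?thesis
        by simp
    qed
    \<comment> \<open>Conjugate transposition and, below, conjugation by J both send U = J'J to its
      inverse JJ'; injectivity near 0 turns this into two sign rules for X.\<close>
    have "mexp (hconj X) = mexp (- X)"
      using X(1) minus by (simp add: hconj_mexp[symmetric] U_def hconj_mult hJ hJ')
    then have skew: "hconj X = - X"
      by (rule mexp_inj_near_0[rotated 2]) (use X(2) in simp_all)
    have "J ** mexp X = mexp (J ** X ** J) ** J"
      by (rule mexp_intertwine) (simp add: matrix_mul_assoc[symmetric] JJ)
    then have "mexp (J ** X ** J) ** (J ** J) = J ** U ** J"
      by (simp only: matrix_mul_assoc X(1))
    then have "mexp (J ** X ** J) = J ** U ** J"
      by (simp add: JJ)
    also have "\<dots> = J ** J'"
      by (simp add: U_def matrix_mul_assoc[symmetric] JJ)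
    finally have "mexp (J ** X ** J) = mexp (- X)"
      by (simp add: minus)
    moreover have "norm (J ** X ** J) \<le> 1/4"
    proof -
      have "norm (J ** X ** J) \<le> norm (J ** X) * j"
        unfolding j_def by (rule norm_matrix_mult)
      also have "\<dots> \<le> (j * norm X) * j"
        unfolding j_def by (intro mult_right_mono norm_matrix_mult) simp
      also have "\<dots> \<le> (j * (4 * (\<delta> * j))) * j"
        using normX D j mult_right_mono[of "norm D" \<delta> j] by (intro mult_right_mono mult_left_mono) auto
      also have "\<dots> \<le> 1/4"
        using \<delta>j(2) by (simp add: mult_ac)
      finally show ?thesis .
    qed
    ultimately have "J ** X ** J = - X"
      by (rule mexp_inj_near_0[rotated 2]) (use X(2) in simp_all)
    then have "(J ** X ** J) ** J = (- X) ** J"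
      by simp
    then have anti: "J ** X = - (X ** J)"
      by (simp add: matrix_mul_assoc[symmetric] JJ matrix_simps)
    define \<Omega> where "\<Omega> = (1/2) *\<^sub>R X"
    have double: "mexp \<Omega> ** mexp \<Omega> = mexp X"
      by (simp add: mexp_add_commuting \<Omega>_def flip: scaleR_add_left)
    have inter: "J ** mexp (- \<Omega>) = mexp \<Omega> ** J"
      by (rule mexp_intertwine) (simp add: \<Omega>_def matrix_simps anti)
    \<comment> \<open>Moving J past the right factor reverses the sign of the exponent, so the two
      factors combine to U; this is the reason for halving X.\<close>
    have "mexp \<Omega> ** J ** mexp (- \<Omega>) = (mexp \<Omega> ** mexp \<Omega>) ** J"
      by (simp only: matrix_mul_assoc[symmetric] inter)
    also have "\<dots> = J' ** (J ** J)"
      by (simp only: double X(1) U_def matrix_mul_assoc)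
    finally have conjJ: "mexp \<Omega> ** J ** mexp (- \<Omega>) = J'"
      by (simp add: JJ)
    have P_J: "R = (1/2) *\<^sub>R ((2 *\<^sub>R R - mat 1) + mat 1)" for R :: "complex^'n^'n"
      by simp
    have conj: "mexp \<Omega> ** P ** mexp (- \<Omega>) = P'"
    proof -
      have "mexp \<Omega> ** P ** mexp (- \<Omega>) = (1/2) *\<^sub>R (mexp \<Omega> ** J ** mexp (- \<Omega>) + mat 1)"
        by (subst P_J[of P]) (simp add: J_def[symmetric] matrix_simps)
      then show ?thesis
        using P_J[of P'] by (simp add: conjJ J'_def)
    qed
    \<comment> \<open>Idempotence of P' gives DJ = [D,P] - D^2, and 2DJ is the exponential of X
      minus the identity. Both error terms are therefore quadratic in D.\<close>
    have "\<Omega> - comm D P = - ((1/2) *\<^sub>R (mexp X - mat 1 - X)) - D ** D"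
    proof -
      have "P ** D + D ** P + D ** D = D"
        using GrassD(2)[OF P'] GrassD(2)[OF P] by (simp add: D_def matrix_simps)
      then have "D ** D = D - P ** D - D ** P"
        by (simp add: algebra_simps)
      moreover have "D ** J = D ** P + D ** P - D"
        by (simp only: J_def matrix_simps scaleR_2 matrix_mul_rid)
      ultimately have "D ** J = comm D P - D ** D"
        by (simp add: comm_def)
      moreover have "mexp X - mat 1 = 2 *\<^sub>R (D ** J)"
        using U1 X(1) by simp
      ultimately show ?thesis
        by (simp add: \<Omega>_def scaleR_diff_right)
    qed
    then have "norm (\<Omega> - comm D P) \<le> 1/2 * norm (mexp X - mat 1 - X) + norm (D ** D)"
      using norm_triangle_ineq4[of "- ((1/2) *\<^sub>R (mexp X - mat 1 - X))" "D ** D"] by simp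
    also have "\<dots> \<le> 1/2 * (2 * (norm X)\<^sup>2) + norm D * norm D"
      using X(2) by (intro add_mono mult_left_mono mexp_remainder_le norm_matrix_mult) auto
    also have "\<dots> \<le> 1/2 * (2 * (4 * (norm D * j))\<^sup>2) + norm D * norm D"
      using normX by (intro add_mono mult_left_mono power_mono) auto
    also have "\<dots> = (16 * j\<^sup>2 + 1) * (norm D)\<^sup>2"
      by (simp add: power2_eq_square algebra_simps)
    finally have est: "norm (\<Omega> - comm D P) \<le> (16 * j\<^sup>2 + 1) * (norm D)\<^sup>2" .
    have "norm \<Omega> \<le> norm (\<Omega> - comm D P) + norm (comm D P)"
      using norm_triangle_ineq[of "\<Omega> - comm D P" "comm D P"] by simp
    also have "\<dots> \<le> (16 * j\<^sup>2 + 1) * norm D + 2 * norm D * norm P"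
    proof (intro add_mono norm_comm_le order_trans[OF est] mult_left_mono)
      show "(norm D)\<^sup>2 \<le> norm D"
        using D \<delta> mult_left_mono[of "norm D" 1 "norm D"] by (simp add: power2_eq_square)
    qed (use j in auto)
    also have "\<dots> = C * norm D"
      by (simp add: C_def algebra_simps)
    finally have "norm \<Omega> \<le> C * norm D" .
    moreover have "norm (\<Omega> - comm D P) \<le> C * (norm D)\<^sup>2"
      by (rule order_trans[OF est], rule mult_right_mono) (simp_all add: C_def)
    moreover have "hconj \<Omega> = - \<Omega>"
      by (simp add: \<Omega>_def skew)
    ultimately show ?thesis
      using conj by (intro exI[of _ \<Omega>]) (simp add: D_def)
  qed
  show ?thesis
    by (rule that[OF \<delta> \<open>0 \<le> C\<close>]) (intro ballI impI main)
qed

section \<open>Differentiability of the squared distance\<close>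

lemma continuous_on_riem_exp: "continuous_on UNIV (riem_exp Q)"
  unfolding riem_exp_def[abs_def] geodesic_def comm_def
  by (intro continuous_intros continuous_on_compose2[OF continuous_on_mexp[of UNIV]]) auto

text \<open>A crude bound that estimates the linear term by its absolute value. It serves to bound
  minimizing velocities in the compactness argument and to show that balls are open.\<close>

lemma grass_dist_upper_near:
  assumes Q: "Q \<in> Grass m" and P: "P \<in> Grass m" and \<xi>: "\<xi> \<in> tangent Q" "riem_exp Q \<xi> = P"
  obtains \<delta> K where "0 < \<delta>" "\<delta> \<le> 1" "0 \<le> K"
    "\<forall>P'\<in>Grass m. norm (P' - P) < \<delta> \<longrightarrow> (grass_dist m Q P')\<^sup>2 \<le> (norm \<xi>)\<^sup>2 + K * norm (P' - P)"
proof -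
  define A where "A = comm \<xi> Q"
  obtain \<delta> C where \<delta>: "0 < \<delta>" "\<delta> \<le> 1" and C: "0 \<le> C" and
    log: "\<forall>P'\<in>Grass m. norm (P' - P) < \<delta> \<longrightarrow> (\<exists>\<Omega>. hconj \<Omega> = - \<Omega> \<and>
       mexp \<Omega> ** P ** mexp (- \<Omega>) = P' \<and> norm \<Omega> \<le> C * norm (P' - P) \<and>
       norm (\<Omega> - comm (P' - P) P) \<le> C * (norm (P' - P))\<^sup>2)"
    by (rule Grass_local_log[OF P])
  define K where "K = 2 * norm A * C + 4 * m * (C * C)"
  have "K \<ge> 0"
    using C by (simp add: K_def)
  moreover have "(grass_dist m Q P')\<^sup>2 \<le> (norm \<xi>)\<^sup>2 + K * norm (P' - P)"
    if P': "P' \<in> Grass m" and close: "norm (P' - P) < \<delta>" for P'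
  proof -
    define d where "d = norm (P' - P)"
    have d: "0 \<le> d" "d \<le> 1"
      using close \<delta> by (simp_all add: d_def)
    obtain \<Omega> where \<Omega>: "hconj \<Omega> = - \<Omega>" "mexp \<Omega> ** P ** mexp (- \<Omega>) = P'" "norm \<Omega> \<le> C * d"
      using log[rule_format, OF P' close] unfolding d_def by blast
    have "(grass_dist m Q P')\<^sup>2 \<le> (norm \<xi>)\<^sup>2 - 2 * grass_metric A \<Omega> + 4 * m * (norm \<Omega>)\<^sup>2"
      using grass_dist_variation_le[OF Q \<xi>(1) \<Omega>(1)] by (simp add: A_def \<Omega>(2) \<xi>(2))
    moreover have "- 2 * grass_metric A \<Omega> \<le> 2 * (norm A * (C * d))"
      using grass_metric_le[of A \<Omega>] mult_left_mono[OF \<Omega>(3) norm_ge_zero[of A]] by linarith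
    \<comment> \<open>One of the two factors d is replaced by 1, so that the quadratic term is
      absorbed into the linear bound.\<close>
    moreover have "4 * m * (norm \<Omega>)\<^sup>2 \<le> 4 * m * ((C * d) * (C * 1))"
      unfolding power2_eq_square
      by (intro mult_left_mono mult_mono \<Omega>(3) order_trans[OF \<Omega>(3)] mult_nonneg_nonneg C d) simp_all
    ultimately show ?thesis
      by (simp add: K_def d_def algebra_simps)
  qed
  ultimately show ?thesis
    using that[OF \<delta>] by blast
qed

text \<open>A limit of minimizing velocities is minimizing, so uniqueness of the minimizing velocity
  at \<open>P\<close> and compactness of bounded sets of tangent vectors force convergence.\<close>

lemma minimizing_velocity_continuous:
  fixes Q P :: "complex^'n^'n"
  assumes Q: "Q \<in> Grass m" and P: "P \<in> Grass m"
    and \<xi>: "\<xi> \<in> tangent Q" "riem_exp Q \<xi> = P" "norm \<xi> = grass_dist m Q P"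
    and unique: "\<And>\<eta>. \<eta> \<in> tangent Q \<Longrightarrow> riem_exp Q \<eta> = P \<Longrightarrow> norm \<eta> = grass_dist m Q P \<Longrightarrow> \<eta> = \<xi>"
    and e: "e > 0"
  obtains d where "d > 0"
    "\<forall>\<eta>\<in>tangent Q. riem_exp Q \<eta> \<in> Grass m \<longrightarrow> norm (riem_exp Q \<eta> - P) < d \<longrightarrow>
       norm \<eta> = grass_dist m Q (riem_exp Q \<eta>) \<longrightarrow> norm (\<eta> - \<xi>) < e"
proof (rule ccontr)
  assume contr: "\<not> thesis"
  obtain \<delta> K where \<delta>: "0 < \<delta>" "\<delta> \<le> 1" and K: "0 \<le> K"
    and upper: "\<forall>P'\<in>Grass m. norm (P' - P) < \<delta> \<longrightarrow>
       (grass_dist m Q P')\<^sup>2 \<le> (norm \<xi>)\<^sup>2 + K * norm (P' - P)"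
    by (rule grass_dist_upper_near[OF Q P \<xi>(1,2)])
  \<comment> \<open>Radii that tend to 0 without ever leaving the range of
    \<open>upper\<close>.\<close>
  define d where "d n = \<delta> / real (Suc n)" for n
  have d: "d n > 0" "d n \<le> \<delta>" for n
    using \<delta> by (simp_all add: d_def divide_simps)
  have "\<forall>n. \<exists>\<eta>. \<eta> \<in> tangent Q \<and> riem_exp Q \<eta> \<in> Grass m \<and> norm (riem_exp Q \<eta> - P) < d n \<and>
       norm \<eta> = grass_dist m Q (riem_exp Q \<eta>) \<and> norm (\<eta> - \<xi>) \<ge> e"
  proof (rule allI, rule ccontr)
    fix n
    assume "\<not> (\<exists>\<eta>. \<eta> \<in> tangent Q \<and> riem_exp Q \<eta> \<in> Grass m \<and> norm (riem_exp Q \<eta> - P) < d n \<and>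
       norm \<eta> = grass_dist m Q (riem_exp Q \<eta>) \<and> norm (\<eta> - \<xi>) \<ge> e)"
    then have "\<forall>\<eta>\<in>tangent Q. riem_exp Q \<eta> \<in> Grass m \<longrightarrow> norm (riem_exp Q \<eta> - P) < d n \<longrightarrow>
       norm \<eta> = grass_dist m Q (riem_exp Q \<eta>) \<longrightarrow> norm (\<eta> - \<xi>) < e"
      unfolding not_le[symmetric] by blast
    then show False
      using contr that[OF d(1)[of n]] by blast
  qed
  from choice[OF this] obtain \<eta> where \<eta>: "\<forall>n. \<eta> n \<in> tangent Q \<and> riem_exp Q (\<eta> n) \<in> Grass m \<and>
       norm (riem_exp Q (\<eta> n) - P) < d n \<and>
       norm (\<eta> n) = grass_dist m Q (riem_exp Q (\<eta> n)) \<and> norm (\<eta> n - \<xi>) \<ge> e" ..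
  define P' where "P' n = riem_exp Q (\<eta> n)" for n
  have seq: "P' n \<in> Grass m" "norm (P' n - P) < d n" "\<eta> n \<in> tangent Q" "riem_exp Q (\<eta> n) = P' n"
    "norm (\<eta> n) = grass_dist m Q (P' n)" "norm (\<eta> n - \<xi>) \<ge> e" for n
    using \<eta> unfolding P'_def by blast+
  have bound: "(norm (\<eta> n))\<^sup>2 \<le> (norm \<xi>)\<^sup>2 + K * d n" for n
  proof -
    have "norm (P' n - P) < \<delta>"
      using seq(2)[of n] d(2)[of n] by linarith
    then have "(norm (\<eta> n))\<^sup>2 \<le> (norm \<xi>)\<^sup>2 + K * norm (P' n - P)"
      using upper[rule_format, OF seq(1)] by (simp add: seq(5))
    also have "\<dots> \<le> (norm \<xi>)\<^sup>2 + K * d n"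
      using seq(2)[of n] K by (intro add_left_mono mult_left_mono) auto
    finally show ?thesis .
  qed
  define R where "R = sqrt ((norm \<xi>)\<^sup>2 + K * \<delta>)"
  have "\<forall>n. norm (\<eta> n) \<le> R"
  proof
    show "norm (\<eta> n) \<le> R" for n
      unfolding R_def using bound[of n] mult_left_mono[OF d(2)[of n] K] by (intro real_le_rsqrt) linarith
  qed
  then have in_cball: "\<forall>n. \<eta> n \<in> tangent Q \<inter> cball 0 R"
    using seq(3) by simp
  have comp: "compact (tangent Q \<inter> cball 0 R)"
    by (rule closed_Int_compact[OF closed_tangent[OF Q] compact_cball])
  obtain l r where "l \<in> tangent Q \<inter> cball 0 R" and r: "strict_mono r" and lim: "(\<eta> \<circ> r) \<longlonglongrightarrow> l"
    by (rule seq_compactE[OF compact_imp_seq_compact[OF comp] in_cball])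
  then have l: "l \<in> tangent Q"
    by simp
  have d0: "d \<longlonglongrightarrow> 0"
    using tendsto_mult_right_zero[OF LIMSEQ_inverse_real_of_nat, of \<delta>]
    by (simp add: d_def[abs_def] divide_inverse)
  have "P' \<longlonglongrightarrow> P"
    by (rule LIM_zero_cancel, rule Lim_null_comparison[OF _ d0])
      (use seq(2) in \<open>auto intro!: always_eventually less_imp_le\<close>)
  then have "(P' \<circ> r) \<longlonglongrightarrow> P"
    by (rule LIMSEQ_subseq_LIMSEQ[OF _ r])
  moreover have "(P' \<circ> r) \<longlonglongrightarrow> riem_exp Q l"
    using continuous_on_tendsto_compose[OF continuous_on_riem_exp lim, of Q] seq(4) by (simp add: o_def)
  ultimately have lP: "riem_exp Q l = P"
    by (rule LIMSEQ_unique[rotated])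
  \<comment> \<open>Uniqueness speaks of velocities whose length is exactly the distance. One bound
    on the length of l passes to the limit; the other holds because the geodesic of l competes in
    the infimum.\<close>
  have "(norm l)\<^sup>2 \<le> (norm \<xi>)\<^sup>2 + K * 0"
  proof (rule LIMSEQ_le)
    show "(\<lambda>n. (norm ((\<eta> \<circ> r) n))\<^sup>2) \<longlonglongrightarrow> (norm l)\<^sup>2"
      by (intro tendsto_intros lim)
    show "(\<lambda>n. (norm \<xi>)\<^sup>2 + K * (d \<circ> r) n) \<longlonglongrightarrow> (norm \<xi>)\<^sup>2 + K * 0"
      by (intro tendsto_intros LIMSEQ_subseq_LIMSEQ[OF d0 r])
  qed (use bound in auto)
  then have "norm l \<le> norm \<xi>"
    using power2_le_imp_le[of "norm l" "norm \<xi>"] by simp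
  moreover have "grass_dist m Q P \<le> norm l"
    using grass_dist_riem_exp_le(2)[OF Q l] by (simp add: lP)
  ultimately have "l = \<xi>"
    using unique[OF l lP] \<xi>(3) by simp
  then have "(\<lambda>n. norm ((\<eta> \<circ> r) n - \<xi>)) \<longlonglongrightarrow> norm (\<xi> - \<xi>)"
    using lim by (intro tendsto_intros) (simp add: o_def)
  then have "e \<le> norm (\<xi> - \<xi>)"
    by (rule LIMSEQ_le_const) (use seq(6) in auto)
  then show False
    using e by simp
qed

text \<open>The upper and the lower bound on the increment differ by terms quadratic in D and by the
  pairing of B - A with \<Omega>, where A and B are the generators for P and P'. That pairing is
  o(|D|) because \<Omega> is O(|D|) and the minimizing velocities converge.\<close>

lemma grass_dist_sq_has_derivative:
  fixes Q P :: "complex^'n^'n"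
  assumes Q: "Q \<in> Grass m" and P: "P \<in> Grass m"
    and \<xi>: "\<xi> \<in> tangent Q" "riem_exp Q \<xi> = P" "norm \<xi> = grass_dist m Q P"
    and unique: "\<And>\<eta>. \<eta> \<in> tangent Q \<Longrightarrow> riem_exp Q \<eta> = P \<Longrightarrow> norm \<eta> = grass_dist m Q P \<Longrightarrow> \<eta> = \<xi>"
    and \<rho>: "\<rho> > 0" and exist: "\<And>P'. P' \<in> Grass m \<Longrightarrow> norm (P' - P) < \<rho> \<Longrightarrow>
       \<exists>\<eta>\<in>tangent Q. riem_exp Q \<eta> = P' \<and> norm \<eta> = grass_dist m Q P'"
  shows "((\<lambda>X. (grass_dist m Q X)\<^sup>2) has_derivative
    (\<lambda>D. 2 * grass_metric (comm (comm \<xi> Q) P) D)) (at P within Grass m)"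
proof -
  define A where "A = comm \<xi> Q"
  obtain \<delta> C where \<delta>: "0 < \<delta>" "\<delta> \<le> 1" and C: "0 \<le> C" and
    log: "\<forall>P'\<in>Grass m. norm (P' - P) < \<delta> \<longrightarrow> (\<exists>\<Omega>. hconj \<Omega> = - \<Omega> \<and>
       mexp \<Omega> ** P ** mexp (- \<Omega>) = P' \<and> norm \<Omega> \<le> C * norm (P' - P) \<and>
       norm (\<Omega> - comm (P' - P) P) \<le> C * (norm (P' - P))\<^sup>2)"
    by (rule Grass_local_log[OF P])
  have dual: "grass_metric (comm A P) D = - grass_metric A (comm D P)" for D
  proof -
    have "trace (P ** A ** D) = trace (A ** (D ** P))"
      using trace_mul_sym[of P "A ** D"] by (simp add: matrix_mul_assoc)
    then show ?thesis
      by (simp add: grass_metric_def comm_def matrix_simps trace_sub matrix_mul_assoc)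
  qed
  define K where "K = 4 * m * (C * C) + 2 * norm A * C"
  have K: "K \<ge> 0"
    using C by (simp add: K_def)
  have "bounded_linear (\<lambda>D. 2 * grass_metric (comm A P) D)"
    by (intro bounded_linear_const_mult bounded_linear_grass_metric)
  moreover have "\<exists>d>0. \<forall>P'\<in>Grass m. norm (P' - P) < d \<longrightarrow>
      norm ((grass_dist m Q P')\<^sup>2 - (grass_dist m Q P)\<^sup>2 - 2 * grass_metric (comm A P) (P' - P))
        \<le> e * norm (P' - P)" if e: "e > 0" for e
  proof -
    \<comment> \<open>The cross-term error is at most 2 (2 e' |Q|)(C |D|), and this choice makes it
      at most half of e |D|; the summand 1 keeps the denominator positive. The last entry of the
      minimum \<open>d\<close> leaves the other half to the quadratic terms collected in
      \<open>K\<close>.\<close>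
    define e' where "e' = e / (2 * (4 * norm Q * C + 1))"
    have pos: "4 * norm Q * C + 1 > 0" "K + 1 > 0"
      using C K by (simp_all add: add_nonneg_pos)
    have e': "e' > 0" "4 * norm Q * C * e' \<le> e / 2"
      using e pos(1) C by (simp_all add: e'_def divide_simps)
    obtain d1 where d1: "d1 > 0" "\<forall>\<eta>\<in>tangent Q. riem_exp Q \<eta> \<in> Grass m \<longrightarrow>
        norm (riem_exp Q \<eta> - P) < d1 \<longrightarrow> norm \<eta> = grass_dist m Q (riem_exp Q \<eta>) \<longrightarrow> norm (\<eta> - \<xi>) < e'"
      by (rule minimizing_velocity_continuous[OF Q P \<xi> unique e'(1)])
    define d where "d = min (min \<delta> \<rho>) (min d1 (e / (2 * (K + 1))))"
    have "d > 0"
      using \<delta> \<rho> d1 e pos by (simp add: d_def)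
    moreover have "norm ((grass_dist m Q P')\<^sup>2 - (grass_dist m Q P)\<^sup>2 - 2 * grass_metric (comm A P) (P' - P))
        \<le> e * norm (P' - P)" if P': "P' \<in> Grass m" and close: "norm (P' - P) < d" for P'
    proof -
      define D where "D = P' - P"
      have D: "norm D < \<delta>" "norm D < \<rho>" "norm D < d1" "norm D < e / (2 * (K + 1))"
        using close by (simp_all add: d_def D_def)
      obtain \<Omega> where \<Omega>: "hconj \<Omega> = - \<Omega>" "mexp \<Omega> ** P ** mexp (- \<Omega>) = P'" "norm \<Omega> \<le> C * norm D"
          "norm (\<Omega> - comm D P) \<le> C * (norm D)\<^sup>2"
        using log[rule_format, OF P' D(1)[unfolded D_def]] unfolding D_def by blast
      obtain \<eta> where \<eta>: "\<eta> \<in> tangent Q" "riem_exp Q \<eta> = P'" "norm \<eta> = grass_dist m Q P'"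
        using exist[OF P' D(2)[unfolded D_def]] by blast
      have \<eta>\<xi>: "norm (\<eta> - \<xi>) < e'"
        using d1(2)[rule_format, OF \<eta>(1)] P' D(3) \<eta>(3) by (simp add: \<eta>(2) D_def)
      define B where "B = comm \<eta> Q"
      have BA: "norm (B - A) \<le> 2 * e' * norm Q"
      proof -
        have "norm (B - A) \<le> 2 * norm (\<eta> - \<xi>) * norm Q"
          unfolding A_def B_def by (subst comm_diff_left[symmetric]) (rule norm_comm_le)
        also have "\<dots> \<le> 2 * e' * norm Q"
          using \<eta>\<xi> by (intro mult_right_mono) auto
        finally show ?thesis .
      qed
      have upper: "(grass_dist m Q P')\<^sup>2 \<le> (grass_dist m Q P)\<^sup>2 - 2 * grass_metric A \<Omega> + 4 * m * (norm \<Omega>)\<^sup>2"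
        using grass_dist_variation_le[OF Q \<xi>(1) \<Omega>(1)] by (simp add: A_def \<Omega>(2) \<xi>(2,3))
      have "mexp (- \<Omega>) ** P' ** mexp (- (- \<Omega>)) = P"
        unfolding \<Omega>(2)[symmetric] minus_minus by (rule mexp_conj_inverse)
      then have lower: "(grass_dist m Q P)\<^sup>2 \<le> (grass_dist m Q P')\<^sup>2 + 2 * grass_metric B \<Omega> + 4 * m * (norm \<Omega>)\<^sup>2"
        using grass_dist_variation_le[OF Q \<eta>(1), of "- \<Omega>"] \<Omega>(1)
        by (simp add: B_def \<eta>(2,3) grass_metric_inner)
      have \<Omega>sq: "(norm \<Omega>)\<^sup>2 \<le> C * C * (norm D)\<^sup>2"
        using power_mono[OF \<Omega>(3), of 2] by (simp add: power_mult_distrib power2_eq_square mult_ac)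
      have 1: "\<bar>grass_metric (B - A) \<Omega>\<bar> \<le> (2 * e' * norm Q) * (C * norm D)"
        by (rule order_trans[OF grass_metric_le])
          (use e' in \<open>intro mult_mono BA \<Omega>(3) mult_nonneg_nonneg; simp\<close>)
      have 2: "\<bar>grass_metric A (\<Omega> - comm D P)\<bar> \<le> norm A * (C * (norm D)\<^sup>2)"
        by (rule order_trans[OF grass_metric_le]) (intro mult_left_mono \<Omega>(4), simp)
      have 3: "grass_metric (B - A) \<Omega> = grass_metric B \<Omega> - grass_metric A \<Omega>"
        "grass_metric A (\<Omega> - comm D P) = grass_metric A \<Omega> - grass_metric A (comm D P)"
        by (simp_all add: grass_metric_inner inner_diff_left inner_diff_right)
      have 4: "4 * m * (norm \<Omega>)\<^sup>2 \<le> 4 * m * (C * C * (norm D)\<^sup>2)"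
        by (intro mult_left_mono \<Omega>sq) simp
      have "\<bar>(grass_dist m Q P')\<^sup>2 - (grass_dist m Q P)\<^sup>2 - 2 * grass_metric (comm A P) D\<bar>
          \<le> 2 * ((2 * e' * norm Q) * (C * norm D)) + 4 * m * (C * C * (norm D)\<^sup>2)
            + 2 * (norm A * (C * (norm D)\<^sup>2))"
        using upper lower 1 2 4 unfolding dual 3 by linarith
      also have "\<dots> = (4 * norm Q * C * e') * norm D + (K * norm D) * norm D"
        by (simp add: K_def power2_eq_square algebra_simps)
      also have "\<dots> \<le> (e / 2) * norm D + (e / 2) * norm D"
      proof (intro add_mono mult_right_mono e'(2))
        have "K * norm D \<le> (K + 1) * norm D"
          by (simp add: algebra_simps)
        also have "\<dots> \<le> (K + 1) * (e / (2 * (K + 1)))"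
          using D(4) pos by (intro mult_left_mono) auto
        also have "\<dots> = e / 2"
        proof -
          have "k * (e / (2 * k)) = e / 2" if "k > 0" for k :: real
            using that by simp
          then show ?thesis
            using pos(2) .
        qed
        finally show "K * norm D \<le> e / 2" .
      qed simp_all
      finally show ?thesis
        by (simp add: D_def)
    qed
    ultimately show ?thesis
      by blast
  qed
  ultimately show ?thesis
    unfolding has_derivative_within_alt A_def by blast
qed

section \<open>Geodesically convex balls\<close>

lemma shortest_geodesic_velocity:
  assumes Q: "Q \<in> Grass m" and "shortest_geodesic m Q P \<gamma>"
  obtains H where "H \<in> tangent Q" "\<forall>t\<in>{0..1}. \<gamma> t = geodesic Q H t" "riem_exp Q H = P"
    "norm H = grass_dist m Q P"
proof -
  obtain H where H: "H \<in> tangent Q" "\<forall>t\<in>{0..1}. \<gamma> t = geodesic Q H t"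
    and "\<gamma> 1 = P" "curve_length \<gamma> = grass_dist m Q P"
    using assms(2) unfolding shortest_geodesic_def by blast
  moreover have "curve_length \<gamma> = norm H"
    using H by (intro curve_length_geodesic[OF Q]) auto
  ultimately show ?thesis
    using that[OF H] by (simp add: riem_exp_def)
qed

lemma shortest_geodesicI:
  assumes Q: "Q \<in> Grass m" and H: "H \<in> tangent Q" "riem_exp Q H = P" "norm H = grass_dist m Q P"
  shows "shortest_geodesic m Q P (geodesic Q H)"
  unfolding shortest_geodesic_def
  using curve_length_geodesic[OF Q H(1), of "geodesic Q H"] H by (auto simp: riem_exp_def)

lemma geodesic_velocity_unique:
  assumes Q: "Q \<in> Grass m" and H: "H \<in> tangent Q"
    and \<gamma>: "\<forall>t\<in>{0..1}. \<gamma> t = geodesic Q H t" and D: "(\<gamma> has_vector_derivative D) (at 0 within {0..1})"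
  shows "D = H"
proof -
  have "(geodesic Q H has_vector_derivative H) (at 0 within {0..1})"
    by (rule has_vector_derivative_at_within[OF geodesic_has_vector_derivative_0[OF Q H]])
  then have "(\<gamma> has_vector_derivative H) (at 0 within {0..1})"
    by (rule has_vector_derivative_transform[rotated 2]) (use \<gamma> in auto)
  moreover have "at (0::real) within {0..1} \<noteq> bot"
    by (simp add: trivial_limit_within)
  ultimately show ?thesis
    using D vector_derivative_unique_within by blast
qed

text \<open>Uniqueness of curves becomes uniqueness of velocities, since a geodesic on [0,1]
  determines its one-sided derivative at 0.\<close>

lemma convex_ball_velocity:
  assumes B: "geodesically_convex_open_ball m B" and QP: "Q \<in> B" "P \<in> B"
  obtains H where "Q \<in> Grass m" "P \<in> Grass m" "H \<in> tangent Q" "riem_exp Q H = P" "norm H = grass_dist m Q P"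
    "\<forall>t\<in>{0..1}. geodesic Q H t \<in> B"
    "\<forall>\<eta>\<in>tangent Q. riem_exp Q \<eta> = P \<longrightarrow> norm \<eta> = grass_dist m Q P \<longrightarrow> \<eta> = H"
proof -
  have "B \<subseteq> Grass m"
    using B by (auto simp: geodesically_convex_open_ball_def open_ball_def)
  then have Q: "Q \<in> Grass m" and P: "P \<in> Grass m"
    using QP by auto
  obtain \<gamma> where \<gamma>: "shortest_geodesic m Q P \<gamma>" "\<gamma> ` {0..1} \<subseteq> B"
    and unique: "\<forall>\<gamma>'. shortest_geodesic m Q P \<gamma>' \<longrightarrow> (\<forall>t\<in>{0..1}. \<gamma>' t = \<gamma> t)"
    using B QP unfolding geodesically_convex_open_ball_def by blast
  obtain H where H: "H \<in> tangent Q" "\<forall>t\<in>{0..1}. \<gamma> t = geodesic Q H t" "riem_exp Q H = P"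
    "norm H = grass_dist m Q P"
    by (rule shortest_geodesic_velocity[OF Q \<gamma>(1)])
  have "\<eta> = H" if \<eta>: "\<eta> \<in> tangent Q" "riem_exp Q \<eta> = P" "norm \<eta> = grass_dist m Q P" for \<eta>
  proof (rule geodesic_velocity_unique[OF Q H(1)])
    show "\<forall>t\<in>{0..1}. geodesic Q \<eta> t = geodesic Q H t"
      using unique[rule_format, OF shortest_geodesicI[OF Q \<eta>]] H(2) by simp
    show "(geodesic Q \<eta> has_vector_derivative \<eta>) (at 0 within {0..1})"
      by (rule has_vector_derivative_at_within[OF geodesic_has_vector_derivative_0[OF Q \<eta>(1)]])
  qed
  moreover have "\<forall>t\<in>{0..1}. geodesic Q H t \<in> B"
    using \<gamma>(2) H(2) by force
  ultimately show ?thesis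
    using that[OF Q P H(1,3,4)] by blast
qed

lemma is_initial_velocity_iff:
  assumes Q: "Q \<in> Grass m" and H: "H \<in> tangent Q" "riem_exp Q H = P" "norm H = grass_dist m Q P"
    "\<forall>t\<in>{0..1}. geodesic Q H t \<in> B"
    and unique: "\<forall>\<eta>\<in>tangent Q. riem_exp Q \<eta> = P \<longrightarrow> norm \<eta> = grass_dist m Q P \<longrightarrow> \<eta> = H"
  shows "is_initial_velocity m B Q P \<xi> \<longleftrightarrow> \<xi> = H"
proof
  assume "is_initial_velocity m B Q P \<xi>"
  then obtain \<gamma> where \<gamma>: "shortest_geodesic m Q P \<gamma>" "(\<gamma> has_vector_derivative \<xi>) (at 0 within {0..1})"
    unfolding is_initial_velocity_def by blast
  obtain K where K: "K \<in> tangent Q" "\<forall>t\<in>{0..1}. \<gamma> t = geodesic Q K t" "riem_exp Q K = P"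
    "norm K = grass_dist m Q P"
    by (rule shortest_geodesic_velocity[OF Q \<gamma>(1)])
  have "\<xi> = K"
    by (rule geodesic_velocity_unique[OF Q K(1,2) \<gamma>(2)])
  then show "\<xi> = H"
    using unique K by simp
next
  assume "\<xi> = H"
  moreover have "(geodesic Q H has_vector_derivative H) (at 0 within {0..1})"
    by (rule has_vector_derivative_at_within[OF geodesic_has_vector_derivative_0[OF Q H(1)]])
  ultimately show "is_initial_velocity m B Q P \<xi>"
    unfolding is_initial_velocity_def using shortest_geodesicI[OF Q H(1-3)] H(1,4) by blast
qed

text \<open>The ball is intrinsic while derivatives use the ambient norm. The gap between r^2 and
  the squared distance of P from the centre leaves room for the linear growth bound.\<close>

lemma convex_ball_open:
  fixes P :: "complex^'n^'n"
  assumes B: "geodesically_convex_open_ball m B" and P: "P \<in> B"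
  obtains \<rho> where "\<rho> > 0" "\<forall>P'\<in>Grass m. norm (P' - P) < \<rho> \<longrightarrow> P' \<in> B"
proof -
  obtain C r where C: "C \<in> Grass m" and r: "r > 0" and ball: "B = open_ball m C r"
    using B unfolding geodesically_convex_open_ball_def by blast
  \<comment> \<open>The zero velocity shows that the centre lies in the ball, so convexity provides
    a minimizing velocity from the centre to P.\<close>
  have "0 \<in> tangent C"
    by (simp add: tangent_Grass_iff[OF C] matrix_simps)
  moreover have "riem_exp C 0 = C"
    by (simp add: riem_exp_def geodesic_def comm_0_left)
  ultimately have "grass_dist m C C \<le> 0"
    using grass_dist_riem_exp_le(2)[OF C, of 0] by simp
  then have "C \<in> B"
    using C r by (simp add: ball open_ball_def)
  then obtain H where H: "P \<in> Grass m" "H \<in> tangent C" "riem_exp C H = P" "norm H = grass_dist m C P"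
    by (rule convex_ball_velocity[OF B _ P])
  obtain \<delta> K where \<delta>: "0 < \<delta>" "\<delta> \<le> 1" and K: "0 \<le> K"
    and upper: "\<forall>P'\<in>Grass m. norm (P' - P) < \<delta> \<longrightarrow>
       (grass_dist m C P')\<^sup>2 \<le> (norm H)\<^sup>2 + K * norm (P' - P)"
    by (rule grass_dist_upper_near[OF C H(1-3)])
  have "norm H < r"
    using P H(4) by (simp add: ball open_ball_def)
  then have gap: "r\<^sup>2 - (norm H)\<^sup>2 > 0"
    by (simp add: power_strict_mono)
  define \<rho> where "\<rho> = min \<delta> ((r\<^sup>2 - (norm H)\<^sup>2) / (K + 1))"
  have "P' \<in> B" if P': "P' \<in> Grass m" and close: "norm (P' - P) < \<rho>" for P'
  proof -
    have "(K + 1) * norm (P' - P) < r\<^sup>2 - (norm H)\<^sup>2"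
      using close K by (simp add: \<rho>_def pos_less_divide_eq mult.commute)
    then have "K * norm (P' - P) < r\<^sup>2 - (norm H)\<^sup>2"
      using norm_ge_zero[of "P' - P"] by (simp only: distrib_right)
    moreover have "(grass_dist m C P')\<^sup>2 \<le> (norm H)\<^sup>2 + K * norm (P' - P)"
      using upper P' close by (simp add: \<rho>_def)
    ultimately have "(grass_dist m C P')\<^sup>2 < r\<^sup>2"
      by linarith
    then have "grass_dist m C P' < r"
      using power_less_imp_less_base r by fastforce
    then show ?thesis
      using P' by (simp add: ball open_ball_def)
  qed
  moreover have "\<rho> > 0"
    using \<delta>(1) gap K by (simp add: \<rho>_def add_nonneg_pos)
  ultimately show ?thesis
    using that by blast
qed

section \<open>The gradient\<close>

text \<open>Chain rule on an open set of times during which the curve stays in the Grassmannian;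
  openness then restores the two-sided derivative at 0.\<close>

lemma has_directional_derivativeI:
  fixes P :: "complex^'n^'n"
  assumes F: "(F has_derivative F') (at P within Grass m)"
  shows "has_directional_derivative m F P H (F' H)"
  unfolding has_directional_derivative_def
proof (intro allI impI, elim conjE)
  fix \<gamma> :: "real \<Rightarrow> complex^'n^'n"
  assume \<gamma>0: "\<gamma> 0 = P" and ev: "\<forall>\<^sub>F t in nhds 0. \<gamma> t \<in> Grass m"
    and \<gamma>: "(\<gamma> has_vector_derivative H) (at 0)"
  obtain S where S: "open S" "0 \<in> S" "\<And>t. t \<in> S \<Longrightarrow> \<gamma> t \<in> Grass m"
    using ev by (auto simp: eventually_nhds)
  have "(\<gamma> has_derivative (\<lambda>h. h *\<^sub>R H)) (at 0 within S)"
    using \<gamma> has_derivative_at_withinI unfolding has_vector_derivative_def by blast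
  moreover have "(F has_derivative F') (at (\<gamma> 0) within \<gamma> ` S)"
    unfolding \<gamma>0 using S(3) by (intro has_derivative_subset[OF F]) auto
  ultimately have "((F \<circ> \<gamma>) has_derivative (F' \<circ> (\<lambda>h. h *\<^sub>R H))) (at 0 within S)"
    by (rule diff_chain_within)
  moreover have "F' \<circ> (\<lambda>h. h *\<^sub>R H) = (*) (F' H)"
    using linear_cmul[OF has_derivative_linear[OF F]] by (auto simp: fun_eq_iff mult.commute)
  ultimately show "((\<lambda>t. F (\<gamma> t)) has_real_derivative F' H) (at 0)"
    using at_within_open[OF S(2,1)] by (simp add: has_field_derivative_def o_def)
qed

text \<open>Both gradients are tested in the direction G - G'. As
  \<open>has_directional_derivative\<close> quantifies over curves, an actual curve with this
  velocity has to be exhibited; the geodesic serves.\<close>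

lemma has_riem_gradient_unique:
  assumes P: "P \<in> Grass m" and G: "has_riem_gradient m F P G" "has_riem_gradient m F P G'"
  shows "G = G'"
proof -
  have tangent: "G \<in> tangent P" "G' \<in> tangent P"
    using G by (simp_all add: has_riem_gradient_def)
  have H: "hconj (G - G') = G - G'"
    using tangent by (simp add: tangentD(1)[OF P])
  have "(G - G') ** P + P ** (G - G') = (G ** P + P ** G) - (G' ** P + P ** G')"
    by (simp add: matrix_simps)
  then have "G - G' \<in> tangent P"
    using H tangent by (simp add: tangent_Grass_iff[OF P])
  have skew: "hconj (comm (G - G') P) = - comm (G - G') P"
    by (rule tangentD(4)[OF P \<open>G - G' \<in> tangent P\<close>])
  define \<gamma> where "\<gamma> = geodesic P (G - G')"
  have "\<gamma> 0 = P"
    by (simp add: \<gamma>_def geodesic_def)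
  moreover have "\<forall>\<^sub>F t in nhds 0. \<gamma> t \<in> Grass m"
    using variation_Grass[OF P _ skew, of 0] by (simp add: \<gamma>_def geodesic_eq_variation)
  moreover have "(\<gamma> has_vector_derivative (G - G')) (at 0)"
    unfolding \<gamma>_def by (rule geodesic_has_vector_derivative_0[OF P \<open>G - G' \<in> tangent P\<close>])
  ultimately have "((\<lambda>t. F (\<gamma> t)) has_real_derivative grass_metric X (G - G')) (at 0)"
    if "has_riem_gradient m F P X" for X
    using that \<open>G - G' \<in> tangent P\<close> unfolding has_riem_gradient_def has_directional_derivative_def by blast
  from DERIV_unique[OF this[OF G(1)] this[OF G(2)]] have "grass_metric (G - G') (G - G') = 0"
    by (simp add: grass_metric_diff)
  then show ?thesis
    by (simp add: grass_metric_hermitian[OF H])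
qed

lemma tangent_scaleR_sum:
  assumes P: "P \<in> Grass m" and f: "\<And>i. i \<in> I \<Longrightarrow> f i \<in> tangent P"
  shows "r *\<^sub>R (\<Sum>i\<in>I. f i) \<in> tangent P"
proof -
  note iff = tangent_Grass_iff[OF P]
  have "(\<Sum>i\<in>I. f i) \<in> tangent P"
    using f
  proof (induction I rule: infinite_finite_induct)
    case (insert x I)
    have "f x \<in> tangent P" "(\<Sum>i\<in>I. f i) \<in> tangent P"
      using insert by auto
    then have "hconj (f x) = f x" "f x ** P + P ** f x = f x"
      "hconj (\<Sum>i\<in>I. f i) = (\<Sum>i\<in>I. f i)" "(\<Sum>i\<in>I. f i) ** P + P ** (\<Sum>i\<in>I. f i) = (\<Sum>i\<in>I. f i)"
      unfolding iff by auto
    moreover have "(f x + (\<Sum>i\<in>I. f i)) ** P + P ** (f x + (\<Sum>i\<in>I. f i))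
        = (f x ** P + P ** f x) + ((\<Sum>i\<in>I. f i) ** P + P ** (\<Sum>i\<in>I. f i))"
      by (simp add: matrix_simps)
    ultimately show ?case
      unfolding iff using insert(1,2) by simp
  qed (simp_all add: iff matrix_simps)
  then show ?thesis
    unfolding iff by (simp add: matrix_simps flip: scaleR_add_right)
qed

theorem theorem4:
  fixes m N :: nat and B :: "(complex^'n^'n) set" and Q :: "nat \<Rightarrow> complex^'n^'n"
    and P :: "complex^'n^'n"
  assumes "0 < m" and "m < CARD('n)"
    and "geodesically_convex_open_ball m B"
    and "N \<ge> 1" and "\<And>i. i \<in> {1..N} \<Longrightarrow> Q i \<in> B"
    and "P \<in> B"
  shows "(\<forall>i\<in>{1..N}.
            (\<exists>!\<xi>. is_initial_velocity m B (Q i) P \<xi>) \<and>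
            riem_exp (Q i) (initial_velocity m B (Q i) P) = P \<and>
            trace (initial_velocity m B (Q i) P ** initial_velocity m B (Q i) P)
              = of_real ((grass_dist m P (Q i))\<^sup>2)) \<and>
         (\<exists>!G. has_riem_gradient m (karcher_mean_fun m N Q) P G) \<and>
         riem_gradient m (karcher_mean_fun m N Q) P
           = (2 / real N) *\<^sub>R (\<Sum>i=1..N. comm (comm (initial_velocity m B (Q i) P) (Q i)) P)"
proof -
  note B = assms(3) and QB = assms(5) and PB = assms(6)
  define \<xi> where "\<xi> i = initial_velocity m B (Q i) P" for i
  define G where "G = (2 / real N) *\<^sub>R (\<Sum>i=1..N. comm (comm (\<xi> i) (Q i)) P)"
  obtain \<rho> where \<rho>: "\<rho> > 0" "\<forall>P'\<in>Grass m. norm (P' - P) < \<rho> \<longrightarrow> P' \<in> B"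
    by (rule convex_ball_open[OF B PB])
  have P: "P \<in> Grass m"
    by (rule convex_ball_velocity[OF B PB PB])
  have velocity: "(\<exists>!\<xi>. is_initial_velocity m B (Q i) P \<xi>) \<and> riem_exp (Q i) (\<xi> i) = P \<and>
      trace (\<xi> i ** \<xi> i) = of_real ((grass_dist m P (Q i))\<^sup>2) \<and> comm (comm (\<xi> i) (Q i)) P \<in> tangent P \<and>
      ((\<lambda>X. (grass_dist m X (Q i))\<^sup>2) has_derivative
        (\<lambda>D. 2 * grass_metric (comm (comm (\<xi> i) (Q i)) P) D)) (at P within Grass m)"
    if i: "i \<in> {1..N}" for i
  proof -
    obtain H where Q: "Q i \<in> Grass m" and "P \<in> Grass m"
      and H: "H \<in> tangent (Q i)" "riem_exp (Q i) H = P" "norm H = grass_dist m (Q i) P"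
        "\<forall>t\<in>{0..1}. geodesic (Q i) H t \<in> B"
      and unique: "\<forall>\<eta>\<in>tangent (Q i). riem_exp (Q i) \<eta> = P \<longrightarrow> norm \<eta> = grass_dist m (Q i) P \<longrightarrow> \<eta> = H"
      by (rule convex_ball_velocity[OF B QB[OF i] PB])
    have iff: "is_initial_velocity m B (Q i) P \<eta> \<longleftrightarrow> \<eta> = H" for \<eta>
      by (rule is_initial_velocity_iff[OF Q H unique])
    have \<xi>: "\<xi> i = H"
      by (simp add: \<xi>_def initial_velocity_def iff)
    have "trace (H ** H) = of_real ((norm H)\<^sup>2)"
    proof (rule complex_eqI)
      show "Re (trace (H ** H)) = Re (of_real ((norm H)\<^sup>2))"
        using grass_metric_hermitian[OF tangentD(1)[OF Q H(1)]] by (simp add: grass_metric_def)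
      have "cnj (trace (H ** H)) = trace (H ** H)"
        using trace_hconj[of "H ** H"] by (simp add: hconj_mult tangentD(1)[OF Q H(1)])
      then show "Im (trace (H ** H)) = Im (of_real ((norm H)\<^sup>2))"
        by (simp add: complex_eq_iff)
    qed
    moreover have "((\<lambda>X. (grass_dist m (Q i) X)\<^sup>2) has_derivative
        (\<lambda>D. 2 * grass_metric (comm (comm H (Q i)) P) D)) (at P within Grass m)"
    \<comment> \<open>All projectors near P lie in the ball, so convexity supplies the minimizing
      velocities from Q i towards them.\<close>
    proof (rule grass_dist_sq_has_derivative[OF Q P H(1-3) _ \<rho>(1)])
      fix P'
      assume P': "P' \<in> Grass m" and "norm (P' - P) < \<rho>"
      then have "P' \<in> B"
        using \<rho>(2) by blast
      then obtain \<eta> where "\<eta> \<in> tangent (Q i)" "riem_exp (Q i) \<eta> = P'" "norm \<eta> = grass_dist m (Q i) P'"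
        by (rule convex_ball_velocity[OF B QB[OF i]])
      then show "\<exists>\<eta>\<in>tangent (Q i). riem_exp (Q i) \<eta> = P' \<and> norm \<eta> = grass_dist m (Q i) P'"
        by blast
    qed (use unique in blast)
    moreover have "comm (comm H (Q i)) P \<in> tangent P"
      by (rule comm_skew_tangent[OF tangentD(4)[OF Q H(1)]])
    ultimately show ?thesis
      using H(2,3) by (simp add: \<xi> iff grass_dist_commute[of m _ "Q i"])
  qed
  have "(karcher_mean_fun m N Q has_derivative
      (\<lambda>D. (1 / real N) * (\<Sum>i=1..N. 2 * grass_metric (comm (comm (\<xi> i) (Q i)) P) D))) (at P within Grass m)"
    unfolding karcher_mean_fun_def[abs_def]
    by (intro has_derivative_mult_right has_derivative_sum) (use velocity in blast)
  moreover have "(\<lambda>D. (1 / real N) * (\<Sum>i=1..N. 2 * grass_metric (comm (comm (\<xi> i) (Q i)) P) D)) = grass_metric G"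
    by (simp add: fun_eq_iff G_def grass_metric_scaleR grass_metric_sum sum_distrib_left)
  ultimately have "(karcher_mean_fun m N Q has_derivative grass_metric G) (at P within Grass m)"
    by simp
  then have grad: "has_riem_gradient m (karcher_mean_fun m N Q) P G"
    unfolding has_riem_gradient_def G_def using velocity
    by (auto intro!: tangent_scaleR_sum[OF P] has_directional_derivativeI)
  then have unique: "X = G" if "has_riem_gradient m (karcher_mean_fun m N Q) P X" for X
    using has_riem_gradient_unique[OF P that] by blast
  then have "riem_gradient m (karcher_mean_fun m N Q) P = G"
    unfolding riem_gradient_def using grad by (intro the_equality)
  then show ?thesis
    using velocity grad unique unfolding G_def \<xi>_def by blast
qed

end
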